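(* Let $q>1$, let $u_0\in L^1_{loc}(\Omega)$ with $u_0\ge 0$ a.e. in $\Omega$, and let $V\in L^1_{loc}(\Omega\times[0,+\infty))$. Assume that for some $C>0$ $$V(x,t)\ge C\,d(x)^{-q-1}f(d(x))^{q-1}\quad\text{for a.e. }x\in\Omega,\ t\in[0,+\infty),$$ where $f:(0,\operatorname{diam}(\Omega)]\to[1,+\infty)$ is nonincreasing in a right-neighborhood of $0$ and such that $\lim_{\varepsilon\to 0^+}f(\varepsilon)=+\infty$. If $u$ is a nonnegative weak solution of $$\begin{cases}\partial_t u-\Delta u=V u^q&\text{in }\Omega\times(0,+\infty),\\ u=0&\text{on }\partial\Omega\times(0,+\infty),\\ u=u_0&\text{in }\Omega\times\{0\},\end{cases}$$ then $u=0$ a.e. in $\Omega\times(0,+\infty)$.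
   Context: $\Omega\subset\mathbb{R}^N$, $N\ge 3$, is an open bounded connected set, and $d(x):=\operatorname{dist}(x,\partial\Omega)$ for $x\in\overline\Omega$. Weak solution (the paper's definition of weak solution with $p=2$): a function $u\in W^{1,2}_{loc}(\Omega\times[0,+\infty))\cap L^q_{loc}(\Omega\times[0,+\infty),V\,dx\,dt)$ is a weak solution of the problem in the claim if $u\ge 0$ a.e. in $\Omega\times(0,+\infty)$ and for every $\varphi\in\operatorname{Lip}(\Omega\times[0,\infty))$ with $\varphi\ge 0$ and with compact support in $\Omega\times[0,\infty)$ one has $$\int_0^{\infty}\!\int_{\Omega}Vu^q\varphi\,dx\,dt\le\int_0^{\infty}\!\int_{\Omega}\langle\nabla u,\nabla\varphi\rangle\,dx\,dt-\int_0^{\infty}\!\int_{\Omega}u\,\partial_t\varphi\,dx\,dt-\int_{\Omega}u_0\,\varphi(x,0)\,dx.$$ Here $\nabla$ is the gradient in the $x$ variable. *)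

theory Defs
  imports "HOL-Analysis.Analysis"
begin

text \<open>
  Local spaces on a set \<open>S\<close> that need not be open: the conditions are imposed on every compact
  subset of \<open>S\<close>. For \<open>S = \<Omega> \<times> {0..}\<close> the compact sets may touch the initial time, but not the
  lateral boundary. Points of \<open>\<Omega> \<times> {0..}\<close> are pairs \<open>(x, t)\<close>.
\<close>

definition L1_loc :: "'e::euclidean_space set \<Rightarrow> ('e \<Rightarrow> 'b::euclidean_space) \<Rightarrow> bool" where
  "L1_loc S f \<longleftrightarrow> (\<forall>K. compact K \<and> K \<subseteq> S \<longrightarrow> f absolutely_integrable_on K)"

text \<open>\<open>L\<^sup>p\<close> with respect to the measure with density \<open>w\<close>, locally on \<open>S\<close>.\<close>

definition Lp_loc ::
  "real \<Rightarrow> ('e \<Rightarrow> real) \<Rightarrow> 'e::euclidean_space set \<Rightarrow> ('e \<Rightarrow> 'b::euclidean_space) \<Rightarrow> bool" where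
  "Lp_loc p w S f \<longleftrightarrow> (\<forall>K. compact K \<and> K \<subseteq> S \<longrightarrow>
     f \<in> borel_measurable (lebesgue_on K) \<and>
     (\<lambda>x. w x * norm (f x) powr p) absolutely_integrable_on K)"

text \<open>
  Weak gradient on an open set \<open>U\<close>, tested against \<open>C\<^sup>1\<close> functions with compact support in \<open>U\<close>
  (as in Gilbarg and Trudinger, Section 7.3); test functions are extended by zero to the whole
  space, and \<open>D\<close> is the classical gradient of \<open>\<phi>\<close>.
\<close>

definition has_weak_gradient ::
  "'e::euclidean_space set \<Rightarrow> ('e \<Rightarrow> real) \<Rightarrow> ('e \<Rightarrow> 'e) \<Rightarrow> bool" where
  "has_weak_gradient U u g \<longleftrightarrow> L1_loc U u \<and> L1_loc U g \<and>
     (\<forall>\<phi> D. (\<forall>x. GDERIV \<phi> x :> D x) \<and> continuous_on UNIV D \<and>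
        (\<exists>K. compact K \<and> K \<subseteq> U \<and> (\<forall>x. x \<notin> K \<longrightarrow> \<phi> x = 0)) \<longrightarrow>
        (\<forall>b\<in>Basis. (LINT x:U|lebesgue. u x * (D x \<bullet> b)) = - (LINT x:U|lebesgue. (g x \<bullet> b) * \<phi> x)))"

text \<open>\<open>u\<close> is in \<open>W\<^sup>1\<^sup>,\<^sup>2\<close>, locally on \<open>S\<close>, with weak gradient \<open>g\<close>.\<close>

definition W12_loc ::
  "'e::euclidean_space set \<Rightarrow> ('e \<Rightarrow> real) \<Rightarrow> ('e \<Rightarrow> 'e) \<Rightarrow> bool" where
  "W12_loc S u g \<longleftrightarrow> has_weak_gradient (interior S) u g \<and>
     Lp_loc 2 (\<lambda>_. 1) S u \<and> Lp_loc 2 (\<lambda>_. 1) S g"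

text \<open>
  The classical gradient. For Lipschitz functions it is only used almost everywhere, where it
  exists by Rademacher's theorem; the unspecified values on the remaining null set do not affect
  Lebesgue integrals.
\<close>

definition gradient :: "('e::euclidean_space \<Rightarrow> real) \<Rightarrow> 'e \<Rightarrow> 'e" where
  "gradient \<phi> x = (THE D. GDERIV \<phi> x :> D)"

text \<open>Nonnegative Lipschitz functions on \<open>S\<close> with compact support in \<open>S\<close>.\<close>

definition lip_test :: "'e::euclidean_space set \<Rightarrow> ('e \<Rightarrow> real) \<Rightarrow> bool" where
  "lip_test S \<phi> \<longleftrightarrow> (\<exists>L. L-lipschitz_on S \<phi>) \<and> (\<forall>x\<in>S. 0 \<le> \<phi> x) \<and>
     (\<exists>K. compact K \<and> K \<subseteq> S \<and> (\<forall>x\<in>S - K. \<phi> x = 0))"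

text \<open>
  Nonnegative weak solutions of \<open>\<partial>\<^sub>t u - \<Delta> u = V u\<^sup>q\<close> in \<open>\<Omega> \<times> {0<..}\<close> with initial datum \<open>u\<^sub>0\<close>.
  They satisfy an integral inequality, and since test functions vanish near the lateral boundary,
  the condition \<open>u = 0\<close> there is not encoded. On \<open>\<Omega> \<times> {0<..}\<close>, the first component of a
  space-time gradient is the gradient in \<open>x\<close> and the second one is the time derivative.
\<close>

definition weak_solution ::
  "'a::euclidean_space set \<Rightarrow> ('a \<times> real \<Rightarrow> real) \<Rightarrow> real \<Rightarrow> ('a \<Rightarrow> real) \<Rightarrow> ('a \<times> real \<Rightarrow> real) \<Rightarrow> bool"
  where
  "weak_solution \<Omega> V q u0 u \<longleftrightarrow>
     Lp_loc q V (\<Omega> \<times> {0..}) u \<and>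
     (AE z in lebesgue. z \<in> \<Omega> \<times> {0<..} \<longrightarrow> 0 \<le> u z) \<and>
     (\<exists>g. W12_loc (\<Omega> \<times> {0..}) u g \<and>
       (\<forall>\<phi>. lip_test (\<Omega> \<times> {0..}) \<phi> \<longrightarrow>
          (LINT z:\<Omega> \<times> {0<..}|lebesgue. V z * u z powr q * \<phi> z)
          \<le> (LINT z:\<Omega> \<times> {0<..}|lebesgue. fst (g z) \<bullet> fst (gradient \<phi> z))
            - (LINT z:\<Omega> \<times> {0<..}|lebesgue. u z * snd (gradient \<phi> z))
            - (LINT x:\<Omega>|lebesgue. u0 x * \<phi> (x, 0))))"

end

theory Submission
  imports Defs
begin

text \<open>
  Every point \<open>c\<close> of \<open>\<Omega>\<close> is the centre of a ball inside \<open>\<Omega>\<close> of radius \<open>R = d c\<close> that touches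
  the boundary in a point \<open>p\<close>. Two effects compete on the radius from \<open>c\<close> to \<open>p\<close>. By Hopf's boundary
  point principle for the ball, a nontrivial supersolution is at least of the order of the distance
  to \<open>p\<close>. On the other hand, at distance \<open>\<epsilon>\<close> from \<open>p\<close> the potential is at least of the order
  \<open>\<epsilon> powr (- q - 1) * f \<epsilon> powr (q - 1)\<close>, and the equation tested at the scale \<open>\<epsilon>\<close> then forces \<open>u\<close> to
  be at most of the order \<open>\<epsilon> / f \<epsilon>\<close> on average. Since \<open>f\<close> tends to infinity at 0, \<open>u\<close> has to vanish.

  Both effects are combined in a single test function \<open>\<phi> x * \<psi> t\<close>, where \<open>\<phi>\<close> is essentially
  \<open>1 / \<epsilon>\<close> times the Green function of the touching ball with a pole \<open>y\<close> at distance \<open>\<epsilon>\<close> from \<open>p\<close>,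
  regularized in the ball of radius \<open>\<epsilon> / 4\<close> around \<open>y\<close>. Uniformly in \<open>\<epsilon>\<close> it has the following
  properties (lemma \<open>interior_ball_test_function\<close>, with \<open>N\<close> the dimension of the space): it is at
  least 1 around \<open>c\<close>, its integral is bounded, and \<open>- \<Delta>\<phi>\<close> is at most \<open>K / \<epsilon>\<^sup>2 * \<phi>\<close> on the small ball,
  where \<open>\<phi>\<close> is at most \<open>K / \<epsilon> ^ (N - 1)\<close>, and is nonpositive elsewhere. As \<open>\<phi>\<close> is twice
  continuously differentiable, the gradient of \<open>u\<close> can be integrated away
  (lemma \<open>weak_solution_product_test\<close>):

    \<open>\<integral>\<integral> V u\<^sup>q \<phi> \<psi> \<le> \<integral>\<integral> u (- \<Delta>\<phi> \<psi> - \<phi> \<psi>')\<close>.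

  Let \<open>\<psi>\<close> live on \<open>[0, T]\<close>. Where \<open>u\<close> is above a suitable threshold, the right-hand side is absorbed
  by the left-hand side; where it is below, the right-hand side is explicitly small. If \<open>f \<ge> M\<close> at
  the scale \<open>\<epsilon>\<close>, what remains is at most a constant times \<open>T / M\<close> from the small ball and a
  constant times \<open>T powr (- 1 / (q - 1))\<close> from the decay of \<open>\<psi>\<close> (lemma
  \<open>weak_solution_energy_bound\<close>). With \<open>M = T\<^sup>2\<close> and \<open>T \<rightarrow> \<infinity>\<close>, the integral of \<open>V u\<^sup>q\<close> near \<open>c\<close> is zero,
  and \<open>V\<close> is positive.
\<close>

section \<open>Smooth profiles of one real variable\<close>

lemma DERIV_pos_part_power:
  fixes t :: real
  shows "((\<lambda>t. max 0 t ^ Suc (Suc n)) has_real_derivative real (Suc (Suc n)) * max 0 t ^ Suc n) (at t)"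
proof -
  consider "t < 0" | "t = 0" | "t > 0" by linarith
  then show ?thesis
  proof cases
    case 1
    have "((\<lambda>t. 0 :: real) has_real_derivative 0) (at t)" by simp
    then have "((\<lambda>t. max 0 t ^ Suc (Suc n)) has_real_derivative 0) (at t)"
      by (rule has_field_derivative_transform_within_open[where S = "{..<0}"]) (use 1 in \<open>auto simp: max_def\<close>)
    with 1 show ?thesis by (simp add: max_def)
  next
    case 2
    have "(\<lambda>h::real. max 0 h ^ Suc (Suc n) / h) \<midarrow>0\<rightarrow> 0"
    proof (rule Lim_null_comparison)
      show "\<forall>\<^sub>F h in at (0::real). norm (max 0 h ^ Suc (Suc n) / h) \<le> \<bar>h\<bar> ^ Suc n"
      proof (rule always_eventually, rule allI)
        fix h :: real
        show "norm (max 0 h ^ Suc (Suc n) / h) \<le> \<bar>h\<bar> ^ Suc n"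
        proof (cases "h \<le> 0")
          case True
          then show ?thesis by (simp add: max_absorb1 del: power_Suc)
        qed (auto simp: max_def power_abs)
      qed
      have "((\<lambda>h::real. \<bar>h\<bar> ^ Suc n) \<longlongrightarrow> \<bar>0\<bar> ^ Suc n) (at 0)"
        by (intro tendsto_intros)
      then show "((\<lambda>h::real. \<bar>h\<bar> ^ Suc n) \<longlongrightarrow> 0) (at 0)" by simp
    qed
    with 2 show ?thesis by (simp add: DERIV_def)
  next
    case 3
    have "((\<lambda>t. t ^ Suc (Suc n)) has_real_derivative real (Suc (Suc n)) * t ^ Suc n) (at t)"
      by (rule derivative_eq_intros | simp)+
    then have "((\<lambda>t. max 0 t ^ Suc (Suc n)) has_real_derivative real (Suc (Suc n)) * t ^ Suc n) (at t)"
      by (rule has_field_derivative_transform_within_open[where S = "{0<..}"]) (use 3 in \<open>auto simp: max_def\<close>)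
    with 3 show ?thesis by (simp add: max_def)
  qed
qed

lemma DERIV_pos_part_power_compose:
  assumes "(u has_real_derivative u') (at t)"
  shows "((\<lambda>t. max 0 (u t) ^ 2) has_real_derivative 2 * max 0 (u t) * u') (at t)"
    and "((\<lambda>t. max 0 (u t) ^ 3) has_real_derivative 3 * max 0 (u t) ^ 2 * u') (at t)"
  using DERIV_chain2[OF DERIV_pos_part_power[of 0] assms] DERIV_chain2[OF DERIV_pos_part_power[of 1] assms]
  by (simp_all add: numeral_2_eq_2 numeral_3_eq_3)

text \<open>
  A twice continuously differentiable convex substitute for the positive part: a second difference
  of cubes of positive parts, so that the second derivative is a hat function on \<open>[0, 2]\<close> and the
  function is linear from 2 on. Composed with a subharmonic function it gives a subharmonic function,
  and it cuts off the values below 0. Its derivative is also used as a smooth step from 0 to 6.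
\<close>

definition hinge :: "real \<Rightarrow> real" where
  "hinge t = max 0 t ^ 3 - 2 * max 0 (t - 1) ^ 3 + max 0 (t - 2) ^ 3"

definition hinge' :: "real \<Rightarrow> real" where
  "hinge' t = 3 * (max 0 t ^ 2 - 2 * max 0 (t - 1) ^ 2 + max 0 (t - 2) ^ 2)"

definition hinge'' :: "real \<Rightarrow> real" where
  "hinge'' t = 6 * (max 0 t - 2 * max 0 (t - 1) + max 0 (t - 2))"

lemma DERIV_hinge: "(hinge has_real_derivative hinge' t) (at t)"
  unfolding hinge_def hinge'_def
  by (rule derivative_eq_intros DERIV_pos_part_power_compose refl | simp)+

lemma DERIV_hinge': "(hinge' has_real_derivative hinge'' t) (at t)"
  unfolding hinge'_def hinge''_def
  by (rule derivative_eq_intros DERIV_pos_part_power_compose refl | simp)+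

lemma continuous_hinge'': "continuous_on UNIV hinge''"
  unfolding hinge''_def by (intro continuous_intros)

lemma hinge''_nonneg: "0 \<le> hinge'' t"
  unfolding hinge''_def by (auto simp: max_def)

lemma hinge'_eq:
  "t \<le> 0 \<Longrightarrow> hinge' t = 0" "2 \<le> t \<Longrightarrow> hinge' t = 6"
  unfolding hinge'_def by (auto simp: max_def power2_eq_square algebra_simps)

lemma hinge'_mono: "s \<le> t \<Longrightarrow> hinge' s \<le> hinge' t"
  by (rule DERIV_nonneg_imp_nondecreasing) (use DERIV_hinge' hinge''_nonneg in blast)+

lemma hinge'_bounds: "0 \<le> hinge' t" "hinge' t \<le> 6"
  using hinge'_mono[of "min t 0" t] hinge'_mono[of t "max t 2"] hinge'_eq[of "min t 0"] hinge'_eq[of "max t 2"] by auto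

lemma hinge_eq:
  "t \<le> 0 \<Longrightarrow> hinge t = 0" "2 \<le> t \<Longrightarrow> hinge t = 6 * (t - 1)"
  unfolding hinge_def by (auto simp: max_def power3_eq_cube algebra_simps)

lemma hinge_mono: "s \<le> t \<Longrightarrow> hinge s \<le> hinge t"
  by (rule DERIV_nonneg_imp_nondecreasing) (use DERIV_hinge hinge'_bounds in blast)+

lemma hinge_nonneg: "0 \<le> hinge t"
  using hinge_mono[of "min t 0" t] hinge_eq[of "min t 0"] by auto

lemma hinge_le: "0 \<le> t \<Longrightarrow> hinge t \<le> 6 * t"
proof -
  assume "0 \<le> t"
  have "hinge t - 6 * t \<le> hinge 0 - 6 * 0"
  proof (rule DERIV_nonpos_imp_nonincreasing[OF \<open>0 \<le> t\<close>])
    fix x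
    have "((\<lambda>t. hinge t - 6 * t) has_real_derivative hinge' x - 6) (at x)"
      by (rule derivative_eq_intros DERIV_hinge refl | simp)+
    then show "\<exists>y. ((\<lambda>t. hinge t - 6 * t) has_real_derivative y) (at x) \<and> y \<le> 0"
      using hinge'_bounds(2)[of x] by force
  qed
  then show ?thesis using hinge_eq(1)[of 0] by simp
qed

text \<open>
  Equal to the identity on \<open>[1, \<infinity>)\<close>, nondecreasing on \<open>[0, \<infinity>)\<close> and bounded away from 0.
  Replacing \<open>t\<close> by \<open>soft t\<close> removes the singularity of \<open>t powr (- k)\<close> at 0 while keeping it decreasing
  on \<open>[0, \<infinity>)\<close>; this monotonicity yields the sign of the Green function below.
\<close>

definition soft :: "real \<Rightarrow> real" where
  "soft t = t + max 0 (1 - t) ^ 3 / 3"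

lemma soft_eq: "1 \<le> t \<Longrightarrow> soft t = t"
  by (simp add: soft_def)

lemma DERIV_soft: "(soft has_real_derivative 1 - max 0 (1 - t) ^ 2) (at t)"
  unfolding soft_def
  by (rule derivative_eq_intros DERIV_pos_part_power_compose refl | simp)+

lemma soft_mono: "0 \<le> s \<Longrightarrow> s \<le> t \<Longrightarrow> soft s \<le> soft t"
proof -
  assume st: "0 \<le> s" "s \<le> t"
  show ?thesis
  proof (rule DERIV_nonneg_imp_nondecreasing[OF st(2)])
    fix x assume "s \<le> x" "x \<le> t"
    then have "max 0 (1 - x) ^ 2 \<le> 1" using st by (intro power_le_one) auto
    then show "\<exists>y. (soft has_real_derivative y) (at x) \<and> 0 \<le> y" using DERIV_soft[of x] by force
  qed
qed

lemma soft_ge: "1/3 \<le> soft t"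
proof (cases "0 \<le> t")
  case True
  then show ?thesis using soft_mono[of 0 t] by (simp add: soft_def)
next
  case False
  have "1 + 3 * (- t) \<le> (1 + (- t)) ^ 3"
    using Bernoulli_inequality[of "-t" 3] False by simp
  then show ?thesis using False by (simp add: soft_def max_def algebra_simps)
qed

text \<open>
  With \<open>t\<close> the squared distance to a pole and \<open>2 * (k + 1)\<close> the dimension, \<open>t powr (- k)\<close> is the
  fundamental solution of the Laplace equation up to a factor; here it is regularized in the unit ball.
\<close>

definition riesz :: "real \<Rightarrow> real \<Rightarrow> real" where
  "riesz k t = soft t powr (- k)"

definition riesz' :: "real \<Rightarrow> real \<Rightarrow> real" where
  "riesz' k t = - k * soft t powr (- k - 1) * (1 - max 0 (1 - t) ^ 2)"

definition riesz'' :: "real \<Rightarrow> real \<Rightarrow> real" where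
  "riesz'' k t = k * (k + 1) * soft t powr (- k - 2) * (1 - max 0 (1 - t) ^ 2) ^ 2
     - 2 * k * soft t powr (- k - 1) * max 0 (1 - t)"

lemma soft_pos: "0 < soft t"
  using soft_ge[of t] by linarith

lemma DERIV_riesz: "(riesz k has_real_derivative riesz' k t) (at t)"
proof -
  have "((\<lambda>t. soft t powr (- k)) has_real_derivative
      (- k) * soft t powr (- k - 1) * (1 - max 0 (1 - t) ^ 2)) (at t)"
    using DERIV_fun_powr[OF DERIV_soft soft_pos, of "- k" t] by simp
  moreover have "riesz k = (\<lambda>t. soft t powr (- k))" by (simp add: riesz_def fun_eq_iff)
  ultimately show ?thesis by (simp add: riesz'_def)
qed

lemma DERIV_riesz': "(riesz' k has_real_derivative riesz'' k t) (at t)"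
proof -
  have 1: "((\<lambda>t. soft t powr (- k - 1)) has_real_derivative
      (- k - 1) * soft t powr (- k - 2) * (1 - max 0 (1 - t) ^ 2)) (at t)"
    using DERIV_fun_powr[OF DERIV_soft soft_pos, of "- k - 1" t] by (simp add: algebra_simps)
  have 2: "((\<lambda>t. 1 - max 0 (1 - t) ^ 2) has_real_derivative 2 * max 0 (1 - t)) (at t)"
    by (rule derivative_eq_intros DERIV_pos_part_power_compose refl | simp)+
  show ?thesis
    unfolding riesz'_def riesz''_def
    by (rule derivative_eq_intros 1 2 refl)+ (simp add: algebra_simps power2_eq_square)
qed

lemma continuous_soft: "continuous_on UNIV soft"
  unfolding soft_def by (intro continuous_intros) auto

lemma continuous_riesz'': "continuous_on UNIV (riesz'' k)"
  unfolding riesz''_def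
  by (intro continuous_intros continuous_on_powr continuous_soft) (use soft_pos less_irrefl in metis)+

lemma riesz_decreasing:
  assumes "0 \<le> k" "0 \<le> s" "s \<le> t" shows "riesz k t \<le> riesz k s"
  unfolding riesz_def using soft_mono[OF assms(2,3)] soft_pos[of s] assms(1) by (simp add: powr_mono2')

lemma riesz_eq: "1 \<le> t \<Longrightarrow> riesz k t = t powr (- k)"
  by (simp add: riesz_def soft_eq)

lemma riesz_le: "0 \<le> k \<Longrightarrow> riesz k t \<le> 3 powr k"
proof -
  assume "0 \<le> k"
  have "soft t powr (- k) \<le> (1/3) powr (- k)"
    using soft_ge[of t] \<open>0 \<le> k\<close> by (intro powr_mono2') auto
  also have "\<dots> = 3 powr k" by (simp add: powr_minus powr_divide)
  finally show ?thesis by (simp add: riesz_def)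
qed

text \<open>
  If \<open>P\<close> is a quadratic function in dimension \<open>n\<close> whose Hessian is \<open>s\<close> times the identity and which
  satisfies \<open>|\<nabla>P|\<^sup>2 = 2 * s * P\<close>, then the Laplacian of \<open>g \<circ> P\<close> is
  \<open>s * (2 * P * g'' P + n * g' P)\<close>. The following two lemmas control this expression for the
  regularized kernel.
\<close>

lemma riesz_harmonic:
  assumes "1 \<le> t" "n = 2 * (k + 1)"
  shows "2 * t * riesz'' k t + n * riesz' k t = 0"
proof -
  have m: "max 0 (1 - t) = 0" using assms by simp
  have "t * t powr (- k - 2) = t powr (- k - 1)"
  proof -
    have "1 + (- k - 2) = - k - 1" "0 \<le> t" using assms(1) by simp_all
    with powr_mult_base[of t "- k - 2"] show ?thesis by metis
  qed
  moreover have "2 * t * riesz'' k t = 2 * (k * (k + 1)) * (t * t powr (- k - 2))"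
    unfolding riesz''_def m using assms by (simp add: soft_eq)
  ultimately have "2 * t * riesz'' k t = 2 * (k * (k + 1)) * t powr (- k - 1)" by simp
  then show ?thesis unfolding riesz'_def m using assms by (simp add: soft_eq algebra_simps)
qed

lemma riesz_laplacian_ge:
  assumes "0 \<le> t" "t \<le> 1" "0 \<le> k" "0 \<le> n"
  shows "- (2 * t * riesz'' k t + n * riesz' k t) \<le> (4 + n) * k * 3 powr (k + 1)"
proof -
  have p: "soft t powr (- k - 1) \<le> 3 powr (k + 1)"
    using riesz_le[of "k + 1" t] assms unfolding riesz_def by simp
  have p0: "0 \<le> soft t powr (- k - 1)" by simp
  define a where "a = max 0 (1 - t)"
  have a: "0 \<le> a" "a \<le> 1" and ta: "t = 1 - a" using assms by (auto simp: a_def)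
  have a2: "0 \<le> a\<^sup>2" "a\<^sup>2 \<le> 1" using a by (auto intro: power_le_one)
  have "- (2 * t * riesz'' k t) \<le> 4 * (t * a) * (k * soft t powr (- k - 1))"
    unfolding riesz''_def a_def[symmetric] using assms a a2
    by (simp add: algebra_simps)
  also have "\<dots> \<le> 4 * 1 * (k * 3 powr (k + 1))"
    using p assms a by (intro mult_mono mult_nonneg_nonneg) (auto intro: mult_le_one)
  finally have 1: "- (2 * t * riesz'' k t) \<le> 4 * (k * 3 powr (k + 1))" by simp
  have "- (n * riesz' k t) = n * (k * soft t powr (- k - 1)) * (1 - a\<^sup>2)"
    unfolding riesz'_def a_def[symmetric] by (simp add: mult_ac)
  also have "\<dots> \<le> n * (k * 3 powr (k + 1)) * 1"
    using p assms a a2 by (intro mult_mono mult_nonneg_nonneg) auto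
  finally show ?thesis using 1 by (simp add: algebra_simps)
qed

text \<open>
  The tangent inequality of a convex function. It bounds the Green function from below far from its
  pole, which is the quantitative form of Hopf's lemma used here.
\<close>

lemma powr_minus_diff_ge:
  fixes s t k :: real
  assumes "0 < s" "s \<le> t" "0 \<le> k"
  shows "k * t powr (- k - 1) * (t - s) \<le> s powr (- k) - t powr (- k)"
proof -
  have "t powr (- k) + k * t powr (- k - 1) * t \<le> s powr (- k) + k * t powr (- k - 1) * s"
  proof (rule DERIV_nonpos_imp_nonincreasing[OF assms(2)])
    fix x assume x: "s \<le> x" "x \<le> t"
    have "((\<lambda>s. s powr (- k) + k * t powr (- k - 1) * s) has_real_derivative
        - k * x powr (- k - 1) + k * t powr (- k - 1)) (at x)"
      by (rule derivative_eq_intros DERIV_ident refl | use assms x in simp)+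
    moreover have "t powr (- k - 1) \<le> x powr (- k - 1)"
      using assms x by (intro powr_mono2') auto
    then have "k * t powr (- k - 1) \<le> k * x powr (- k - 1)" using assms by (intro mult_left_mono)
    ultimately show "\<exists>y. ((\<lambda>s. s powr (- k) + k * t powr (- k - 1) * s) has_real_derivative y) (at x) \<and> y \<le> 0"
      by force
  qed
  then show ?thesis by (simp add: algebra_simps)
qed

section \<open>Calculus of twice continuously differentiable functions\<close>

text \<open>
  \<open>G\<close> is the gradient of \<open>\<phi>\<close> and \<open>H b\<close> the gradient of the \<open>b\<close>-th component of \<open>G\<close>, that is,
  a column of the Hessian.
\<close>

definition C2_derivs :: "('e::euclidean_space \<Rightarrow> real) \<Rightarrow> ('e \<Rightarrow> 'e) \<Rightarrow> ('e \<Rightarrow> 'e \<Rightarrow> 'e) \<Rightarrow> bool" where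
  "C2_derivs \<phi> G H \<longleftrightarrow> (\<forall>x. GDERIV \<phi> x :> G x) \<and>
     (\<forall>b\<in>Basis. (\<forall>x. GDERIV (\<lambda>x. G x \<bullet> b) x :> H b x) \<and> continuous_on UNIV (H b))"

definition laplacian :: "('e::euclidean_space \<Rightarrow> 'e \<Rightarrow> 'e) \<Rightarrow> 'e \<Rightarrow> real" where
  "laplacian H x = (\<Sum>b\<in>Basis. H b x \<bullet> b)"

lemma GDERIV_imp_continuous_on:
  fixes \<phi> :: "'e::euclidean_space \<Rightarrow> real"
  shows "(\<And>x. GDERIV \<phi> x :> G x) \<Longrightarrow> continuous_on S \<phi>"
  unfolding gderiv_def
  by (meson continuous_at_imp_continuous_on has_derivative_continuous)

lemma continuous_on_from_Basis:
  fixes G :: "'x::topological_space \<Rightarrow> 'e::euclidean_space"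
  assumes "\<And>b. b \<in> Basis \<Longrightarrow> continuous_on S (\<lambda>x. G x \<bullet> b)"
  shows "continuous_on S G"
proof -
  have "continuous_on S (\<lambda>x. \<Sum>b\<in>Basis. (G x \<bullet> b) *\<^sub>R b)"
    by (intro continuous_on_sum continuous_on_scaleR continuous_on_const assms)
  then show ?thesis by (simp add: euclidean_representation)
qed

lemma C2_derivsD:
  assumes "C2_derivs \<phi> G H"
  shows "GDERIV \<phi> x :> G x" "b \<in> Basis \<Longrightarrow> GDERIV (\<lambda>x. G x \<bullet> b) x :> H b x"
    "b \<in> Basis \<Longrightarrow> continuous_on S (H b)" "continuous_on S \<phi>" "continuous_on S G"
proof -
  show 1: "GDERIV \<phi> x :> G x" "b \<in> Basis \<Longrightarrow> GDERIV (\<lambda>x. G x \<bullet> b) x :> H b x" for x b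
    using assms by (auto simp: C2_derivs_def)
  show "b \<in> Basis \<Longrightarrow> continuous_on S (H b)"
    using assms continuous_on_subset by (force simp: C2_derivs_def)
  show "continuous_on S \<phi>" using 1(1) by (rule GDERIV_imp_continuous_on)
  show "continuous_on S G"
    by (rule continuous_on_from_Basis) (use 1(2) in \<open>rule GDERIV_imp_continuous_on\<close>)
qed

lemma continuous_on_laplacian: "C2_derivs \<phi> G H \<Longrightarrow> continuous_on S (laplacian H)"
  unfolding laplacian_def by (intro continuous_intros C2_derivsD(3))

lemma C2_derivs_compose:
  assumes P: "C2_derivs P G H"
    and g: "\<And>t. (g has_real_derivative g' t) (at t)" "\<And>t. (g' has_real_derivative g'' t) (at t)"
    and c: "continuous_on UNIV g''"
  shows "C2_derivs (\<lambda>x. g (P x)) (\<lambda>x. g' (P x) *\<^sub>R G x)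
           (\<lambda>b x. (g'' (P x) * (G x \<bullet> b)) *\<^sub>R G x + g' (P x) *\<^sub>R H b x)"
  unfolding C2_derivs_def
proof (intro conjI ballI allI)
  fix x :: 'a
  show "GDERIV (\<lambda>x. g (P x)) x :> g' (P x) *\<^sub>R G x"
    by (rule GDERIV_DERIV_compose[OF C2_derivsD(1)[OF P] g(1)])
next
  fix b x :: 'a assume b: "b \<in> Basis"
  have "GDERIV (\<lambda>x. g' (P x) * (G x \<bullet> b)) x :>
      g' (P x) *\<^sub>R H b x + (G x \<bullet> b) *\<^sub>R (g'' (P x) *\<^sub>R G x)"
    by (intro GDERIV_mult GDERIV_DERIV_compose[OF C2_derivsD(1)[OF P] g(2)] C2_derivsD(2)[OF P b])
  then show "GDERIV (\<lambda>x. g' (P x) *\<^sub>R G x \<bullet> b) x :>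
      (g'' (P x) * (G x \<bullet> b)) *\<^sub>R G x + g' (P x) *\<^sub>R H b x"
    by (simp add: algebra_simps)
next
  fix b :: 'a assume b: "b \<in> Basis"
  have "continuous_on UNIV g'" using g(2) by (meson DERIV_isCont continuous_at_imp_continuous_on)
  then show "continuous_on UNIV (\<lambda>x. (g'' (P x) * (G x \<bullet> b)) *\<^sub>R G x + g' (P x) *\<^sub>R H b x)"
    by (intro continuous_intros C2_derivsD[OF P] b)
      (auto intro: continuous_on_compose2[OF _ C2_derivsD(4)[OF P]] c)
qed

lemma sum_Basis_inner_squared: "(\<Sum>b\<in>Basis. (v \<bullet> b) * (v \<bullet> b)) = v \<bullet> v" for v :: "'e::euclidean_space"
  by (simp add: euclidean_inner[of v v])

lemma laplacian_compose:
  "laplacian (\<lambda>b x. (c x * (G x \<bullet> b)) *\<^sub>R G x + d x *\<^sub>R H b x) x = c x * (G x \<bullet> G x) + d x * laplacian H x"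
proof -
  have "laplacian (\<lambda>b x. (c x * (G x \<bullet> b)) *\<^sub>R G x + d x *\<^sub>R H b x) x =
      (\<Sum>b\<in>Basis. c x * ((G x \<bullet> b) * (G x \<bullet> b)) + d x * (H b x \<bullet> b))"
    by (simp add: laplacian_def inner_add_left mult.assoc)
  then show ?thesis by (simp add: sum.distrib laplacian_def sum_Basis_inner_squared flip: sum_distrib_left)
qed

lemma C2_derivs_affine_diff:
  assumes P: "C2_derivs P G H" and Q: "C2_derivs Q G' H'"
  shows "C2_derivs (\<lambda>x. a * (P x - Q x) + c) (\<lambda>x. a *\<^sub>R (G x - G' x)) (\<lambda>b x. a *\<^sub>R (H b x - H' b x))"
  unfolding C2_derivs_def
proof (intro conjI ballI allI)
  fix x :: 'a
  show "GDERIV (\<lambda>x. a * (P x - Q x) + c) x :> a *\<^sub>R (G x - G' x)"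
    by (rule GDERIV_subst)
      (rule GDERIV_add GDERIV_mult GDERIV_diff GDERIV_const C2_derivsD[OF P] C2_derivsD[OF Q] | simp)+
next
  fix b x :: 'a assume b: "b \<in> Basis"
  have "GDERIV (\<lambda>x. a * (G x \<bullet> b - G' x \<bullet> b)) x :> a *\<^sub>R (H b x - H' b x)"
    by (rule GDERIV_subst)
      (rule GDERIV_mult GDERIV_diff GDERIV_const C2_derivsD[OF P] C2_derivsD[OF Q] b | simp)+
  then show "GDERIV (\<lambda>x. a *\<^sub>R (G x - G' x) \<bullet> b) x :> a *\<^sub>R (H b x - H' b x)"
    by (simp add: inner_diff_left)
next
  fix b :: 'a assume b: "b \<in> Basis"
  show "continuous_on UNIV (\<lambda>x. a *\<^sub>R (H b x - H' b x))"
    by (intro continuous_intros C2_derivsD(3)[OF P] C2_derivsD(3)[OF Q] b)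
qed

lemma C2_derivs_quadratic:
  fixes v :: "'e::euclidean_space"
  shows "C2_derivs (\<lambda>x. s / 2 * (x \<bullet> x) + x \<bullet> v + c) (\<lambda>x. s *\<^sub>R x + v) (\<lambda>b x. s *\<^sub>R b)"
  unfolding C2_derivs_def
proof (intro conjI ballI allI)
  fix x :: 'e
  show "GDERIV (\<lambda>x. s / 2 * (x \<bullet> x) + x \<bullet> v + c) x :> s *\<^sub>R x + v"
    unfolding gderiv_def
    by (rule derivative_eq_intros refl)+ (simp add: fun_eq_iff inner_add_right inner_commute)
next
  fix b x :: 'e
  show "GDERIV (\<lambda>x. (s *\<^sub>R x + v) \<bullet> b) x :> s *\<^sub>R b"
    unfolding gderiv_def
    by (rule derivative_eq_intros refl)+ (simp add: fun_eq_iff)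
qed simp

lemma laplacian_quadratic: "laplacian (\<lambda>b x. s *\<^sub>R b) (x :: 'e::euclidean_space) = s * DIM('e)"
  by (simp add: laplacian_def)

lemma GDERIV_unique:
  assumes "GDERIV f x :> D" "GDERIV f x :> E" shows "D = E"
proof -
  have "(\<lambda>h. h \<bullet> D) = (\<lambda>h. h \<bullet> E)"
    using assms unfolding gderiv_def by (rule has_derivative_unique)
  then have "(D - E) \<bullet> D = (D - E) \<bullet> E" by metis
  then have "(D - E) \<bullet> (D - E) = 0" by (simp add: inner_diff_right)
  then show ?thesis by simp
qed

lemma gradient_eq: "GDERIV \<phi> x :> D \<Longrightarrow> gradient \<phi> x = D"
  unfolding gradient_def using GDERIV_unique by blast

lemma GDERIV_zero_outside:
  fixes \<phi> :: "'e::euclidean_space \<Rightarrow> real"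
  assumes "GDERIV \<phi> x :> D" "closed S" "\<And>x. x \<notin> S \<Longrightarrow> \<phi> x = 0" "x \<notin> S"
  shows "D = 0"
proof -
  have "GDERIV (\<lambda>_. 0 :: real) x :> D"
    using assms(1) unfolding gderiv_def
    by (rule has_derivative_transform_within_open[where s = "- S"]) (use assms in auto)
  then show ?thesis using GDERIV_const GDERIV_unique by blast
qed

text \<open>
  The gradient is continuous and vanishes outside a compact set, hence it is bounded.
\<close>

lemma compact_support_C1_lipschitz:
  fixes \<phi> :: "'e::euclidean_space \<Rightarrow> real"
  assumes D: "\<And>x. GDERIV \<phi> x :> D x" and c: "continuous_on UNIV D"
    and S: "compact S" "\<And>x. x \<notin> S \<Longrightarrow> \<phi> x = 0"
  obtains L where "L-lipschitz_on UNIV \<phi>" "\<And>x. norm (D x) \<le> L"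
proof -
  have "bounded (D ` S)"
    using S(1) c by (meson compact_continuous_image compact_imp_bounded continuous_on_subset subset_UNIV)
  then obtain L where L: "L > 0" "\<And>x. x \<in> S \<Longrightarrow> norm (D x) \<le> L" unfolding bounded_pos by auto
  have b: "norm (D x) \<le> L" for x
  proof (cases "x \<in> S")
    case False
    have "D x = 0" by (rule GDERIV_zero_outside[OF D compact_imp_closed[OF S(1)] S(2) False])
    then show ?thesis using L by simp
  qed (use L in auto)
  have "L-lipschitz_on UNIV \<phi>"
  proof (rule bounded_derivative_imp_lipschitz[where f' = "\<lambda>x h. h \<bullet> D x"])
    show "(\<phi> has_derivative (\<lambda>h. h \<bullet> D x)) (at x)" for x using D[of x] by (simp add: gderiv_def)
    show "onorm (\<lambda>h. h \<bullet> D x) \<le> L" for x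
    proof (rule onorm_bound)
      show "norm (h \<bullet> D x) \<le> L * norm h" for h
        using Cauchy_Schwarz_ineq2[of h "D x"] mult_left_mono[OF b[of x], of "norm h"] by (simp add: mult.commute)
    qed (use L in simp)
  qed (use L in auto)
  with b show ?thesis using that by blast
qed

lemma integrable_compact_support:
  fixes f :: "'e::euclidean_space \<Rightarrow> real"
  assumes "continuous_on UNIV f" "compact S" "\<And>x. x \<notin> S \<Longrightarrow> f x = 0"
  shows "integrable lborel f"
proof -
  have "integrable lborel (\<lambda>x. indicator S x *\<^sub>R f x)"
    using assms(1,2) by (intro borel_integrable_compact) (auto intro: continuous_on_subset)
  moreover have "(\<lambda>x. indicator S x *\<^sub>R f x) = f" using assms(3) by (auto simp: indicator_def fun_eq_iff)
  ultimately show ?thesis by simp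
qed

lemma integral_translate:
  fixes f :: "'e::euclidean_space \<Rightarrow> real"
  assumes "f \<in> borel_measurable borel"
  shows "(\<integral>x. f (a + x) \<partial>lborel) = (\<integral>x. f x \<partial>lborel)"
proof -
  have "(\<integral>x. f x \<partial>lborel) = (\<integral>x. f x \<partial>distr lborel borel ((+) a))" by (simp add: lborel_distr_plus)
  also have "\<dots> = (\<integral>x. f (a + x) \<partial>lborel)" using assms by (intro integral_distr) auto
  finally show ?thesis by simp
qed

text \<open>
  The integral of a difference quotient is zero because Lebesgue measure is invariant under
  translations; the quotients converge to the derivative and are dominated by a Lipschitz constant on
  a compact set.
\<close>

lemma integral_derivative_compact_support:
  fixes \<phi> :: "'e::euclidean_space \<Rightarrow> real"
  assumes D: "\<And>x. GDERIV \<phi> x :> D x" and c: "continuous_on UNIV D"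
    and S: "compact S" "\<And>x. x \<notin> S \<Longrightarrow> \<phi> x = 0"
  shows "(\<integral>x. D x \<bullet> b \<partial>lborel) = 0"
proof -
  obtain L where L: "L-lipschitz_on UNIV \<phi>" using compact_support_C1_lipschitz[OF assms] by metis
  have L0: "0 \<le> L" using L by (rule lipschitz_on_nonneg)
  define h where "h = (\<lambda>n. inverse (real (Suc n)))"
  have h: "0 < h n" "h n \<le> 1" for n by (auto simp: h_def field_simps)
  define q where "q = (\<lambda>n x. (\<phi> (h n *\<^sub>R b + x) - \<phi> x) / h n)"
  have cphi: "continuous_on A \<phi>" for A using D by (rule GDERIV_imp_continuous_on)
  then have mphi: "\<phi> \<in> borel_measurable borel" by (intro borel_measurable_continuous_onI)
  have iphi: "integrable lborel \<phi>" by (rule integrable_compact_support[OF cphi S])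
  obtain B where B: "\<And>x. x \<in> S \<Longrightarrow> norm x \<le> B" using compact_imp_bounded[OF S(1)] unfolding bounded_iff by auto
  define T where "T = cball (0::'e) (B + norm b)"
  have out: "\<phi> (h n *\<^sub>R b + x) = 0" "\<phi> x = 0" if "x \<notin> T" for n x
  proof -
    have x: "norm x > B + norm b" using that by (simp add: T_def)
    then have "x \<notin> S" using B[of x] norm_ge_zero[of b] by force
    then show "\<phi> x = 0" by (rule S(2))
    have "norm (h n *\<^sub>R b) \<le> norm b" using h[of n] by (simp add: mult_left_le_one_le)
    moreover have "norm x \<le> norm (h n *\<^sub>R b + x) + norm (h n *\<^sub>R b)" using norm_triangle_ineq4[of "h n *\<^sub>R b + x" "h n *\<^sub>R b"] by simp
    ultimately have "h n *\<^sub>R b + x \<notin> S" using B[of "h n *\<^sub>R b + x"] x by force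
    then show "\<phi> (h n *\<^sub>R b + x) = 0" by (rule S(2))
  qed
  have int0: "(\<integral>x. q n x \<partial>lborel) = 0" for n
  proof -
    have "integrable lborel (\<lambda>x. \<phi> (h n *\<^sub>R b + x))"
      by (rule integrable_compact_support[where S = T]) (auto simp: T_def[symmetric] out intro!: continuous_on_compose2[OF cphi[of UNIV]] continuous_intros, simp add: T_def)
    then show ?thesis
      unfolding q_def using iphi integral_translate[OF mphi, of "h n *\<^sub>R b"] by simp
  qed
  have "(\<lambda>n. \<integral>x. q n x \<partial>lborel) \<longlonglongrightarrow> (\<integral>x. D x \<bullet> b \<partial>lborel)"
  proof (rule integral_dominated_convergence[where w = "\<lambda>x. indicator T x *\<^sub>R (L * norm b)"])
    show "(\<lambda>x. D x \<bullet> b) \<in> borel_measurable lborel"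
      unfolding measurable_lborel2 using c by (intro borel_measurable_continuous_onI continuous_intros)
    show "q n \<in> borel_measurable lborel" for n unfolding q_def using mphi by measurable
    show "integrable lborel (\<lambda>x. indicator T x *\<^sub>R (L * norm b))"
      by (intro borel_integrable_compact) (auto simp: T_def)
    show "AE x in lborel. (\<lambda>n. q n x) \<longlonglongrightarrow> D x \<bullet> b"
    proof (rule AE_I2)
      fix x
      have "((\<lambda>t. x + t *\<^sub>R b) has_derivative (\<lambda>t. t *\<^sub>R b)) (at 0)"
        by (auto intro!: derivative_eq_intros)
      moreover have "(\<phi> has_derivative (\<lambda>h. h \<bullet> D x)) (at (x + 0 *\<^sub>R b))"
        using D[of x] by (simp add: gderiv_def)
      ultimately have "((\<lambda>t. \<phi> (x + t *\<^sub>R b)) has_derivative (\<lambda>t. (t *\<^sub>R b) \<bullet> D x)) (at 0)"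
        by (rule has_derivative_compose)
      then have "DERIV (\<lambda>t. \<phi> (x + t *\<^sub>R b)) 0 :> D x \<bullet> b"
        unfolding has_field_derivative_def by (rule has_derivative_eq_rhs) (auto simp: fun_eq_iff inner_commute)
      then have "((\<lambda>t. (\<phi> (x + t *\<^sub>R b) - \<phi> x) / t) \<longlongrightarrow> D x \<bullet> b) (at 0)" by (simp add: DERIV_def)
      moreover have "filterlim h (at 0) sequentially"
        unfolding filterlim_at
      proof
        show "\<forall>\<^sub>F n in sequentially. h n \<in> UNIV \<and> h n \<noteq> 0"
          by (rule always_eventually) (simp add: h_def)
        show "h \<longlonglongrightarrow> 0" unfolding h_def by (rule LIMSEQ_inverse_real_of_nat)
      qed
      ultimately have "(\<lambda>n. (\<phi> (x + h n *\<^sub>R b) - \<phi> x) / h n) \<longlonglongrightarrow> D x \<bullet> b" by (rule filterlim_compose)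
      then show "(\<lambda>n. q n x) \<longlonglongrightarrow> D x \<bullet> b" by (simp add: q_def add.commute)
    qed
    show "AE x in lborel. norm (q n x) \<le> indicator T x *\<^sub>R (L * norm b)" for n
    proof (rule AE_I2)
      fix x
      show "norm (q n x) \<le> indicator T x *\<^sub>R (L * norm b)"
      proof (cases "x \<in> T")
        case True
        have "\<bar>\<phi> (h n *\<^sub>R b + x) - \<phi> x\<bar> \<le> L * (h n * norm b)"
          using lipschitz_onD[OF L, of "h n *\<^sub>R b + x" x] h[of n] by (simp add: dist_norm)
        then show ?thesis using True h[of n] by (simp add: q_def divide_le_eq mult.commute mult.left_commute)
      qed (simp add: q_def out)
    qed
  qed
  then show ?thesis by (simp add: int0 LIMSEQ_const_iff)
qed

text \<open>
  Green's second identity for \<open>\<phi>\<close> and \<open>\<rho>\<^sup>2 - |x - c|\<^sup>2\<close>, whose Laplacian is \<open>- 2 * DIM('e)\<close>. It turns a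
  bound for \<open>- \<Delta>\<phi>\<close> into a bound for the integral of \<open>\<phi>\<close>. Component by component, the integrand is the
  divergence of a field with compact support.
\<close>

lemma integral_laplacian_paraboloid:
  fixes \<phi> :: "'e::euclidean_space \<Rightarrow> real"
  assumes C2: "C2_derivs \<phi> G H" and S: "compact S" "\<And>x. x \<notin> S \<Longrightarrow> \<phi> x = 0"
  shows "2 * DIM('e) * (\<integral>x. \<phi> x \<partial>lborel) = (\<integral>x. - laplacian H x * (\<rho>\<^sup>2 - (norm (x - c))\<^sup>2) \<partial>lborel)"
proof -
  have G0: "G x = 0" if "x \<notin> S" for x
    using GDERIV_zero_outside[OF C2_derivsD(1)[OF C2] compact_imp_closed[OF S(1)] S(2) that] .
  have H0: "H b x = 0" if "x \<notin> S" "b \<in> Basis" for x b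
    using GDERIV_zero_outside[OF C2_derivsD(2)[OF C2 that(2)] compact_imp_closed[OF S(1)] _ that(1)] G0 by simp
  define Q where "Q = (\<lambda>x. \<rho>\<^sup>2 - (x - c) \<bullet> (x - c))"
  have dQ: "GDERIV Q x :> - 2 *\<^sub>R (x - c)" for x
    unfolding gderiv_def Q_def
    by (rule derivative_eq_intros refl)+ (simp add: fun_eq_iff inner_commute inner_diff_left inner_diff_right)
  have dl: "GDERIV (\<lambda>x. (- 2 *\<^sub>R (x - c)) \<bullet> b) x :> - 2 *\<^sub>R b" for b x
    unfolding gderiv_def
    by (rule derivative_eq_intros refl)+ (simp add: fun_eq_iff inner_commute inner_diff_left inner_diff_right)
  have cQ: "continuous_on UNIV Q" using dQ by (rule GDERIV_imp_continuous_on)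
  \<comment> \<open>The integrand is the \<open>b\<close>-th term of the divergence of \<open>Q *\<^sub>R \<nabla>\<phi> - \<phi> *\<^sub>R \<nabla>Q\<close>.\<close>
  have *: "(\<integral>x. 2 * \<phi> x + (H b x \<bullet> b) * Q x \<partial>lborel) = 0" if b: "b \<in> Basis" for b
  proof -
    define D where "D = (\<lambda>x. (Q x *\<^sub>R H b x + (G x \<bullet> b) *\<^sub>R (- 2 *\<^sub>R (x - c)))
         - (\<phi> x *\<^sub>R (- 2 *\<^sub>R b) + ((- 2 *\<^sub>R (x - c)) \<bullet> b) *\<^sub>R G x))"
    have "(\<integral>x. D x \<bullet> b \<partial>lborel) = 0"
    proof (rule integral_derivative_compact_support[OF _ _ S(1)])
      show "GDERIV (\<lambda>x. Q x * (G x \<bullet> b) - \<phi> x * ((- 2 *\<^sub>R (x - c)) \<bullet> b)) x :> D x" for x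
        unfolding D_def by (intro GDERIV_diff GDERIV_mult dQ dl C2_derivsD[OF C2] b)
      show "continuous_on UNIV D"
        unfolding D_def by (intro continuous_intros cQ C2_derivsD[OF C2] b)
    qed (use G0 S(2) in simp)
    moreover have "D x \<bullet> b = 2 * \<phi> x + (H b x \<bullet> b) * Q x" for x
      using b by (simp add: D_def inner_diff_left inner_add_left algebra_simps)
    ultimately show ?thesis by simp
  qed
  have int: "integrable lborel (\<lambda>x. 2 * \<phi> x)" "b \<in> Basis \<Longrightarrow> integrable lborel (\<lambda>x. (H b x \<bullet> b) * Q x)" for b
    by (rule integrable_compact_support[OF _ S(1)], auto intro!: continuous_intros C2_derivsD[OF C2] cQ simp: S(2) H0)+
  have "0 = (\<Sum>b\<in>Basis. (\<integral>x. 2 * \<phi> x \<partial>lborel) + (\<integral>x. (H b x \<bullet> b) * Q x \<partial>lborel))"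
    using * Bochner_Integration.integral_add[OF int] by (simp add: sum.neutral)
  also have "\<dots> = DIM('e) * (\<integral>x. 2 * \<phi> x \<partial>lborel) + (\<Sum>b\<in>Basis. \<integral>x. (H b x \<bullet> b) * Q x \<partial>lborel)"
    by (simp add: sum.distrib)
  also have "(\<Sum>b\<in>Basis. \<integral>x. (H b x \<bullet> b) * Q x \<partial>lborel) = (\<integral>x. (\<Sum>b\<in>Basis. (H b x \<bullet> b) * Q x) \<partial>lborel)"
    by (rule Bochner_Integration.integral_sum[symmetric]) (rule int)
  also have "(\<lambda>x. \<Sum>b\<in>Basis. (H b x \<bullet> b) * Q x) = (\<lambda>x. laplacian H x * Q x)"
    by (simp add: laplacian_def sum_distrib_right)
  finally show ?thesis
    by (simp add: Q_def power2_norm_eq_inner)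
qed

section \<open>A test function concentrated at a boundary point of a ball\<close>

text \<open>
  Kelvin's image charge, written without inversion. The Green function of the ball of radius \<open>R\<close> around
  \<open>c\<close> with pole \<open>y\<close> is \<open>A powr (- k) - D powr (- k)\<close> up to a factor, where \<open>A\<close> is the squared distance
  to \<open>y\<close> and \<open>D = A + \<beta> * (R\<^sup>2 - |x - c|\<^sup>2)\<close> is a multiple of the squared distance to the image of \<open>y\<close>.
  In this form it is evident that, for \<open>y\<close> in the ball, \<open>D = A\<close> on the sphere and \<open>D \<le> A\<close> outside.
  The second identity is the eikonal relation that makes \<open>D powr (- k)\<close> harmonic, and the inequality
  keeps \<open>D\<close> away from zero in the ball.
\<close>

lemma ball_image_charge_identity:
  fixes c x y :: "'e::euclidean_space"
  assumes R: "0 < R"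
  defines "\<beta> \<equiv> 1 - (norm (y - c))\<^sup>2 / R\<^sup>2"
  shows "(norm (x - y))\<^sup>2 + \<beta> * (R\<^sup>2 - (norm (x - c))\<^sup>2)
           = (1 - \<beta>) * (norm (x - c))\<^sup>2 - 2 * ((x - c) \<bullet> (y - c)) + R\<^sup>2"
    and "(norm ((x - y) - \<beta> *\<^sub>R (x - c)))\<^sup>2
           = (1 - \<beta>) * ((norm (x - y))\<^sup>2 + \<beta> * (R\<^sup>2 - (norm (x - c))\<^sup>2))"
    and "(R - norm (y - c) * norm (x - c) / R)\<^sup>2 \<le> (norm (x - y))\<^sup>2 + \<beta> * (R\<^sup>2 - (norm (x - c))\<^sup>2)"
proof -
  define X Y where "X = x - c" and "Y = y - c"
  have xy: "x - y = X - Y" by (simp add: X_def Y_def)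
  have Y2: "Y \<bullet> Y = R\<^sup>2 * (1 - \<beta>)" using R by (simp add: \<beta>_def Y_def power2_norm_eq_inner)
  have n: "(norm (x - y))\<^sup>2 = X \<bullet> X - 2 * (X \<bullet> Y) + R\<^sup>2 * (1 - \<beta>)"
    unfolding xy power2_norm_eq_inner by (simp add: inner_diff_left inner_diff_right inner_commute Y2)
  show 1: "(norm (x - y))\<^sup>2 + \<beta> * (R\<^sup>2 - (norm (x - c))\<^sup>2)
           = (1 - \<beta>) * (norm (x - c))\<^sup>2 - 2 * ((x - c) \<bullet> (y - c)) + R\<^sup>2"
    unfolding n unfolding X_def[symmetric] Y_def[symmetric] power2_norm_eq_inner by (simp add: algebra_simps)
  have "(norm ((x - y) - \<beta> *\<^sub>R (x - c)))\<^sup>2 = (norm ((1 - \<beta>) *\<^sub>R X - Y))\<^sup>2"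
    unfolding xy unfolding X_def[symmetric] by (simp add: algebra_simps)
  also have "\<dots> = (1 - \<beta>)\<^sup>2 * (X \<bullet> X) - 2 * (1 - \<beta>) * (X \<bullet> Y) + R\<^sup>2 * (1 - \<beta>)"
    unfolding power2_norm_eq_inner
    by (simp add: inner_diff_left inner_diff_right inner_commute Y2 power2_eq_square)
  also have "\<dots> = (1 - \<beta>) * ((1 - \<beta>) * (X \<bullet> X) - 2 * (X \<bullet> Y) + R\<^sup>2)"
    by (simp add: algebra_simps power2_eq_square)
  finally show "(norm ((x - y) - \<beta> *\<^sub>R (x - c)))\<^sup>2
           = (1 - \<beta>) * ((norm (x - y))\<^sup>2 + \<beta> * (R\<^sup>2 - (norm (x - c))\<^sup>2))"
    unfolding 1 unfolding X_def[symmetric] Y_def[symmetric] power2_norm_eq_inner .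
  have "(R - norm Y * norm X / R)\<^sup>2 = R\<^sup>2 - 2 * (norm Y * norm X) + (norm Y)\<^sup>2 / R\<^sup>2 * (norm X)\<^sup>2"
    using R by (simp add: power2_diff power_mult_distrib power_divide)
  also have "\<dots> \<le> R\<^sup>2 - 2 * (X \<bullet> Y) + (norm Y)\<^sup>2 / R\<^sup>2 * (norm X)\<^sup>2"
    using norm_cauchy_schwarz[of X Y] by (simp add: mult.commute)
  finally show "(R - norm (y - c) * norm (x - c) / R)\<^sup>2 \<le> (norm (x - y))\<^sup>2 + \<beta> * (R\<^sup>2 - (norm (x - c))\<^sup>2)"
    unfolding 1 unfolding X_def[symmetric] Y_def[symmetric] by (simp add: \<beta>_def Y_def)
qed

lemma C2_derivs_dist_squared_diff:
  fixes y c :: "'e::euclidean_space"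
  shows "C2_derivs (\<lambda>x. a * ((norm (x - y))\<^sup>2 + \<beta> * (\<rho> - (norm (x - c))\<^sup>2)))
           (\<lambda>x. (2 * a) *\<^sub>R ((x - y) - \<beta> *\<^sub>R (x - c))) (\<lambda>b x. (2 * a * (1 - \<beta>)) *\<^sub>R b)"
proof -
  define v where "v = (2 * a) *\<^sub>R (\<beta> *\<^sub>R c - y)"
  define e where "e = a * (y \<bullet> y + \<beta> * \<rho> - \<beta> * (c \<bullet> c))"
  have "(\<lambda>x. a * ((norm (x - y))\<^sup>2 + \<beta> * (\<rho> - (norm (x - c))\<^sup>2)))
      = (\<lambda>x. (2 * a * (1 - \<beta>)) / 2 * (x \<bullet> x) + x \<bullet> v + e)"
  proof
    fix x
    have half: "(2 * a * (1 - \<beta>)) / 2 = a * (1 - \<beta>)" by simp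
    show "a * ((norm (x - y))\<^sup>2 + \<beta> * (\<rho> - (norm (x - c))\<^sup>2))
        = (2 * a * (1 - \<beta>)) / 2 * (x \<bullet> x) + x \<bullet> v + e"
      unfolding half v_def e_def power2_norm_eq_inner
      by (simp add: inner_diff_left inner_diff_right inner_commute algebra_simps)
  qed
  moreover have "(\<lambda>x. (2 * a) *\<^sub>R ((x - y) - \<beta> *\<^sub>R (x - c))) = (\<lambda>x. (2 * a * (1 - \<beta>)) *\<^sub>R x + v)"
    by (rule ext) (simp add: v_def algebra_simps)
  ultimately show ?thesis using C2_derivs_quadratic[of "2 * a * (1 - \<beta>)" v e] by simp
qed

lemma laplacian_diff: "laplacian (\<lambda>b x. a *\<^sub>R (H b x - H' b x)) x = a * (laplacian H x - laplacian H' x)"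
  by (simp add: laplacian_def inner_diff_left sum_subtractf sum_distrib_left right_diff_distrib)

text \<open>
  The regularized Green function \<open>W\<close> of the touching ball, in units in which the radius \<open>\<epsilon> / 4\<close> of the
  regularization is 1. The image term is left unchanged by the regularization inside the ball, since
  \<open>D\<close> is at least \<open>\<epsilon>\<^sup>2\<close> there; regularizing both terms by the same decreasing function makes \<open>W\<close>
  nonpositive outside the ball without a case distinction in its definition. In these units \<open>W\<close> is of
  order 1 near the pole, and the last property is the decay rate \<open>\<epsilon> ^ (DIM('e) - 1)\<close> at the centre.
\<close>

lemma regularized_green_function:
  fixes c p :: "'e::euclidean_space"
  assumes dim: "3 \<le> DIM('e)" and R: "0 < R" "dist p c = R" and \<epsilon>: "0 < \<epsilon>" "\<epsilon> \<le> R / 4"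
  defines "N \<equiv> real DIM('e)"
  defines "k \<equiv> (N - 2) / 2"
  obtains W G H y where "C2_derivs W G H"
    and "ball y (\<epsilon>/4) \<subseteq> ball p (2 * \<epsilon>)"
    and "\<And>x. R \<le> norm (x - c) \<Longrightarrow> W x \<le> 0"
    and "\<And>x. norm (x - c) < R \<Longrightarrow> x \<notin> ball y (\<epsilon>/4) \<Longrightarrow> laplacian H x = 0"
    and "\<And>x. x \<in> ball y (\<epsilon>/4) \<Longrightarrow> - laplacian H x \<le> 32 * (4 + N) * k * 3 powr (k + 1) / \<epsilon>\<^sup>2"
    and "\<And>x. x \<in> ball y (\<epsilon>/4) \<Longrightarrow> 3/4 \<le> W x \<and> W x \<le> 3 powr k"
    and "\<And>x. x \<in> ball y (\<epsilon>/4) \<Longrightarrow> norm (x - c) < R \<and> R\<^sup>2 - (norm (x - c))\<^sup>2 \<le> 3 * R * \<epsilon>"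
    and "\<And>x. norm (x - c) < R / 2 \<Longrightarrow> 12 * k * R * (80 * R\<^sup>2) powr (- N / 2) * \<epsilon> ^ (DIM('e) - 1) \<le> W x"
proof -
  have N: "3 \<le> N" using dim by (simp add: N_def)
  have k: "1/2 \<le> k" "0 \<le> k" using N by (auto simp: k_def)
  have Nk: "N = 2 * (k + 1)" by (simp add: k_def field_simps)
  define y where "y = c + ((R - \<epsilon>) / R) *\<^sub>R (p - c)"
  have npc: "norm (p - c) = R" using R by (simp add: dist_norm)
  have yc: "norm (y - c) = R - \<epsilon>" using R \<epsilon> npc by (simp add: y_def)
  have "p - y = (1 - (R - \<epsilon>) / R) *\<^sub>R (p - c)" unfolding y_def scaleR_left_diff_distrib by simp
  also have "1 - (R - \<epsilon>) / R = \<epsilon> / R" using R by (simp add: field_simps)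
  finally have "p - y = (\<epsilon> / R) *\<^sub>R (p - c)" .
  then have yp: "norm (p - y) = \<epsilon>" using R \<epsilon> npc by simp
  define \<beta> where "\<beta> = 1 - (norm (y - c))\<^sup>2 / R\<^sup>2"
  have \<beta>: "\<epsilon> / R \<le> \<beta>" "\<beta> \<le> 1" "0 < \<beta>"
  proof -
    have "(1 - \<epsilon> / R)\<^sup>2 \<le> 1 - \<epsilon> / R"
      using \<epsilon> R by (simp add: power2_eq_square mult_left_le_one_le field_simps)
    then show 1: "\<epsilon> / R \<le> \<beta>" using R by (simp add: \<beta>_def yc power_divide[symmetric] diff_divide_distrib)
    show "\<beta> \<le> 1" by (simp add: \<beta>_def)
    have "0 < \<epsilon> / R" using \<epsilon> R by simp
    with 1 show "0 < \<beta>" by linarith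
  qed
  define a where "a = 16 / \<epsilon>\<^sup>2"
  have a: "0 < a" using \<epsilon> by (simp add: a_def)
  \<comment> \<open>The factor 0 puts \<open>P\<close> into the same form as \<open>Q\<close>, so that one derivative rule serves both.\<close>
  define P where "P = (\<lambda>x. a * ((norm (x - y))\<^sup>2 + 0 * (R\<^sup>2 - (norm (x - c))\<^sup>2)))"
  define Q where "Q = (\<lambda>x. a * ((norm (x - y))\<^sup>2 + \<beta> * (R\<^sup>2 - (norm (x - c))\<^sup>2)))"
  note image = ball_image_charge_identity[OF R(1), where y = y and c = c, folded \<beta>_def]
  note CP = C2_derivs_dist_squared_diff[of a y 0 "R\<^sup>2" c, folded P_def]
  note CQ = C2_derivs_dist_squared_diff[of a y \<beta> "R\<^sup>2" c, folded Q_def]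
  define GP where "GP = (\<lambda>x. (2 * a) *\<^sub>R ((x - y) - 0 *\<^sub>R (x - c)))"
  define GQ where "GQ = (\<lambda>x. (2 * a) *\<^sub>R ((x - y) - \<beta> *\<^sub>R (x - c)))"
  define W where "W = (\<lambda>x. 1 * (riesz k (P x) - riesz k (Q x)) + 0)"
  note CgP = C2_derivs_compose[OF CP[folded GP_def] DERIV_riesz DERIV_riesz' continuous_riesz'', of k]
  note CgQ = C2_derivs_compose[OF CQ[folded GQ_def] DERIV_riesz DERIV_riesz' continuous_riesz'', of k]
  note W = C2_derivs_affine_diff[OF CgP CgQ, of 1 0, folded W_def]
  obtain G H where W: "C2_derivs W G H" and lapW: "\<And>x. laplacian H x =
      2 * a * (2 * P x * riesz'' k (P x) + N * riesz' k (P x))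
      - 2 * a * (1 - \<beta>) * (2 * Q x * riesz'' k (Q x) + N * riesz' k (Q x))"
  proof (rule that[OF W])
    fix x
    have gp: "GP x \<bullet> GP x = 4 * a * P x"
      by (simp add: GP_def P_def power2_norm_eq_inner)
    have gq: "GQ x \<bullet> GQ x = 4 * a * (1 - \<beta>) * Q x"
      using image(2)[of x] by (simp add: GQ_def Q_def power2_norm_eq_inner)
    show "laplacian (\<lambda>b x. 1 *\<^sub>R
        (((riesz'' k (P x) * (GP x \<bullet> b)) *\<^sub>R GP x + riesz' k (P x) *\<^sub>R (2 * a * (1 - 0)) *\<^sub>R b)
        - ((riesz'' k (Q x) * (GQ x \<bullet> b)) *\<^sub>R GQ x + riesz' k (Q x) *\<^sub>R (2 * a * (1 - \<beta>)) *\<^sub>R b))) x =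
      2 * a * (2 * P x * riesz'' k (P x) + N * riesz' k (P x))
      - 2 * a * (1 - \<beta>) * (2 * Q x * riesz'' k (Q x) + N * riesz' k (Q x))"
      unfolding laplacian_diff laplacian_compose laplacian_quadratic N_def gp gq by (simp add: algebra_simps)
  qed
  have PQ: "Q x - P x = a * \<beta> * (R\<^sup>2 - (norm (x - c))\<^sup>2)" for x by (simp add: P_def Q_def algebra_simps)
  have P0: "0 \<le> P x" for x using a by (simp add: P_def)
  have Q0: "0 \<le> Q x" for x
    using order_trans[OF zero_le_power2 image(3)[of x]] a by (simp add: Q_def)
  have Q16: "16 \<le> Q x" if "norm (x - c) \<le> R" for x
  proof -
    have "(R - \<epsilon>) * (norm (x - c) / R) \<le> (R - \<epsilon>) * 1" using that R \<epsilon> by (intro mult_left_mono) auto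
    then have "\<epsilon> \<le> R - norm (y - c) * norm (x - c) / R" by (simp add: yc)
    then have "\<epsilon>\<^sup>2 \<le> (R - norm (y - c) * norm (x - c) / R)\<^sup>2" using \<epsilon> by (intro power_mono) auto
    with image(3)[of x] have "a * \<epsilon>\<^sup>2 \<le> Q x" unfolding Q_def using a by (intro mult_left_mono) auto
    then show ?thesis using \<epsilon> by (simp add: a_def)
  qed
  have P1: "P x < 1 \<longleftrightarrow> x \<in> ball y (\<epsilon>/4)" for x
  proof -
    have "P x = (norm (x - y) / (\<epsilon>/4))\<^sup>2" by (simp add: P_def a_def power_divide)
    then have "P x < 1 \<longleftrightarrow> norm (x - y) / (\<epsilon>/4) < 1" using \<epsilon> by (simp add: abs_square_less_1)
    also have "\<dots> \<longleftrightarrow> x \<in> ball y (\<epsilon>/4)" using \<epsilon> by (simp add: dist_norm norm_minus_commute)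
    finally show ?thesis .
  qed
  have near: "norm (x - c) < R \<and> R\<^sup>2 - (norm (x - c))\<^sup>2 \<le> 3 * R * \<epsilon>" if "x \<in> ball y (\<epsilon>/4)" for x
  proof -
    have xy: "norm (x - y) < \<epsilon>/4" using that by (simp add: dist_norm norm_minus_commute)
    have 1: "norm (x - c) \<le> norm (x - y) + norm (y - c)" using norm_triangle_ineq[of "x - y" "y - c"] by simp
    have 2: "norm (y - c) \<le> norm (x - y) + norm (x - c)" using norm_triangle_ineq4[of "x - c" "x - y"] by simp
    have "R\<^sup>2 - (norm (x - c))\<^sup>2 = (R - norm (x - c)) * (R + norm (x - c))" by (simp add: power2_eq_square algebra_simps)
    also have "\<dots> \<le> (5/4 * \<epsilon>) * (2 * R)" using 1 2 xy yc \<epsilon> R by (intro mult_mono) auto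
    also have "\<dots> \<le> 3 * R * \<epsilon>" using \<epsilon> R by simp
    finally show ?thesis using 1 xy yc \<epsilon> by auto
  qed
  show thesis
  proof (rule that[OF W])
    show "ball y (\<epsilon>/4) \<subseteq> ball p (2 * \<epsilon>)"
    proof
      fix x assume "x \<in> ball y (\<epsilon>/4)"
      then show "x \<in> ball p (2 * \<epsilon>)"
        using norm_triangle_ineq[of "p - y" "y - x"] yp \<epsilon> by (simp add: dist_norm)
    qed
    show "W x \<le> 0" if "R \<le> norm (x - c)" for x
    proof -
      have "a * \<beta> * (R\<^sup>2 - (norm (x - c))\<^sup>2) \<le> 0"
        using that R a \<beta> by (intro mult_nonneg_nonpos) (auto intro: power_mono)
      then have "Q x \<le> P x" using PQ[of x] by linarith
      then show ?thesis using riesz_decreasing[OF k(2) Q0] by (simp add: W_def)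
    qed
    show "laplacian H x = 0" if "norm (x - c) < R" "x \<notin> ball y (\<epsilon>/4)" for x
    proof -
      have "1 \<le> Q x" "1 \<le> P x" using Q16[of x] P1[of x] that by auto
      then show ?thesis unfolding lapW by (simp add: riesz_harmonic[OF _ Nk])
    qed
    show "- laplacian H x \<le> 32 * (4 + N) * k * 3 powr (k + 1) / \<epsilon>\<^sup>2" if x: "x \<in> ball y (\<epsilon>/4)" for x
    proof -
      have "1 \<le> Q x" using Q16[of x] near[OF x] by auto
      then have "- laplacian H x = 2 * a * - (2 * P x * riesz'' k (P x) + N * riesz' k (P x))"
        unfolding lapW riesz_harmonic[OF \<open>1 \<le> Q x\<close> Nk] by (simp only: mult_zero_right diff_zero mult_minus_right)
      also have "\<dots> \<le> 2 * a * ((4 + N) * k * 3 powr (k + 1))"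
        using a P0[of x] P1[of x] x k N by (intro mult_left_mono riesz_laplacian_ge) auto
      also have "\<dots> = 32 * (4 + N) * k * 3 powr (k + 1) / \<epsilon>\<^sup>2" by (simp add: a_def mult.assoc)
      finally show ?thesis .
    qed
    show "3/4 \<le> W x \<and> W x \<le> 3 powr k" if x: "x \<in> ball y (\<epsilon>/4)" for x
    proof -
      have "riesz k 1 \<le> riesz k (P x)" using P0[of x] P1[of x] x k by (intro riesz_decreasing) auto
      then have 1: "1 \<le> riesz k (P x)" by (simp add: riesz_eq)
      have "riesz k (Q x) \<le> riesz k 16" using Q16[of x] near[OF x] k by (intro riesz_decreasing) auto
      also have "\<dots> = 16 powr (- k)" by (simp add: riesz_eq)
      also have "\<dots> \<le> 16 powr (- (1/2))" using k by (intro powr_mono) auto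
      also have "\<dots> = 1/4" by (simp add: powr_minus powr_half_sqrt)
      finally have "riesz k (Q x) \<le> 1/4" .
      moreover have "0 \<le> riesz k (Q x)" by (simp add: riesz_def)
      ultimately show ?thesis using 1 riesz_le[OF k(2), of "P x"] by (simp add: W_def)
    qed
    show "norm (x - c) < R \<and> R\<^sup>2 - (norm (x - c))\<^sup>2 \<le> 3 * R * \<epsilon>" if "x \<in> ball y (\<epsilon>/4)" for x
      using near[OF that] .
    show "12 * k * R * (80 * R\<^sup>2) powr (- N / 2) * \<epsilon> ^ (DIM('e) - 1) \<le> W x" if x: "norm (x - c) < R / 2" for x
    proof -
      have far: "R / 4 \<le> norm (x - y)" "norm (x - y) \<le> 2 * R"
        using norm_triangle_ineq4[of "x - c" "x - y"] norm_triangle_ineq4[of "x - c" "y - c"] yc x \<epsilon> R by auto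
      have "x \<notin> ball y (\<epsilon>/4)" using far(1) \<epsilon> R by (auto simp: dist_norm norm_minus_commute)
      then have P1x: "1 \<le> P x" using P1[of x] by auto
      have n2: "(norm (x - c))\<^sup>2 \<le> R\<^sup>2 / 4" using x power_mono[of "norm (x - c)" "R/2" 2] by (simp add: power_divide)
      have "12 * R / \<epsilon> = a * (\<epsilon> / R) * (3/4 * R\<^sup>2)" using \<epsilon> R by (simp add: a_def power2_eq_square)
      also have "\<dots> \<le> a * \<beta> * (R\<^sup>2 - (norm (x - c))\<^sup>2)"
        using a \<beta> n2 \<epsilon> R by (intro mult_mono) auto
      finally have diff: "12 * R / \<epsilon> \<le> Q x - P x" by (simp add: PQ)
      have d0: "0 < 12 * R / \<epsilon>" using \<epsilon> R by simp
      have Q1: "1 \<le> Q x" using diff P1x d0 by linarith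
      have "(norm (x - y))\<^sup>2 \<le> (2 * R)\<^sup>2" using far R by (intro power_mono) auto
      moreover have "\<beta> * (R\<^sup>2 - (norm (x - c))\<^sup>2) \<le> 1 * R\<^sup>2"
        using \<beta> n2 zero_le_power2[of "norm (x - c)"] by (intro mult_mono) linarith+
      ultimately have "Q x \<le> a * (5 * R\<^sup>2)"
        unfolding Q_def using a by (intro mult_left_mono) (auto simp: power2_eq_square)
      then have Qle: "Q x \<le> 80 * R\<^sup>2 / \<epsilon>\<^sup>2" by (simp add: a_def)
      have e: "\<epsilon> ^ DIM('e) = \<epsilon> * \<epsilon> ^ (DIM('e) - 1)" using dim by (simp flip: power_Suc)
      have e2: "(\<epsilon>\<^sup>2) powr (- N / 2) = inverse (\<epsilon> ^ DIM('e))"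
        using \<epsilon> by (simp add: N_def powr_minus powr_powr powr_realpow flip: powr_numeral)
      have "12 * k * R * (80 * R\<^sup>2) powr (- N / 2) * \<epsilon> ^ (DIM('e) - 1)
          = k * ((80 * R\<^sup>2) powr (- N / 2) / (\<epsilon>\<^sup>2) powr (- N / 2)) * (12 * R / \<epsilon>)"
        unfolding e2 e using \<epsilon> by (simp add: field_simps)
      also have "\<dots> = k * (80 * R\<^sup>2 / \<epsilon>\<^sup>2) powr (- N / 2) * (12 * R / \<epsilon>)"
        by (simp add: powr_divide)
      also have "\<dots> \<le> k * Q x powr (- N / 2) * (Q x - P x)"
        using k diff d0 Qle Q1 N by (intro mult_mono powr_mono2' mult_nonneg_nonneg) auto
      also have "\<dots> = k * Q x powr (- k - 1) * (Q x - P x)" by (simp add: k_def diff_divide_distrib)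
      also have "\<dots> \<le> P x powr (- k) - Q x powr (- k)"
        using P1x diff d0 k by (intro powr_minus_diff_ge) auto
      also have "\<dots> = W x" using P1x Q1 by (simp add: W_def riesz_eq)
      finally show ?thesis .
    qed
  qed
qed

lemma laplacian_zero_outside:
  assumes "C2_derivs \<phi> G H" "closed S" "\<And>x. x \<notin> S \<Longrightarrow> \<phi> x = 0" "x \<notin> S"
  shows "laplacian H x = 0"
proof -
  have G0: "G x = 0" if "x \<notin> S" for x
    using GDERIV_zero_outside[OF C2_derivsD(1)[OF assms(1)] assms(2,3) that] .
  have "H b x = 0" if "b \<in> Basis" for b
    using GDERIV_zero_outside[OF C2_derivsD(2)[OF assms(1) that] assms(2) _ assms(4)] G0 by simp
  then show ?thesis by (simp add: laplacian_def)
qed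

text \<open>
  The function is \<open>hinge (\<mu> * W - 1)\<close> with \<open>W\<close> as above and \<open>\<mu>\<close> of order \<open>\<epsilon> ^ -(N - 1)\<close>, where \<open>N\<close> is
  the dimension. Since \<open>\<mu>\<close> is the inverse of the decay rate of \<open>W\<close>, the values around the centre stay
  away from zero. The subtraction of 1 makes the support compact in the ball. Near the pole
  \<open>\<mu> * W\<close> is of order \<open>\<mu>\<close>, which is in the linear range of the hinge; hence \<open>- \<Delta>\<phi>\<close>, of order
  \<open>\<mu> / \<epsilon>\<^sup>2\<close>, is controlled by \<open>\<phi> / \<epsilon>\<^sup>2\<close>. For the integral of \<open>\<phi>\<close>, Green's identity integrates
  \<open>- \<Delta>\<phi>\<close> against \<open>R\<^sup>2 - |x - c|\<^sup>2\<close>, which is of order \<open>\<epsilon>\<close> on the small ball; the powers of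
  \<open>\<epsilon>\<close> cancel.
\<close>

lemma interior_ball_test_function:
  fixes c p :: "'e::euclidean_space"
  assumes dim: "3 \<le> DIM('e)" and R: "0 < R" "dist p c = R"
  obtains K \<epsilon>0 where "0 < K" "0 < \<epsilon>0"
    and "\<And>\<epsilon>. 0 < \<epsilon> \<Longrightarrow> \<epsilon> < \<epsilon>0 \<Longrightarrow> \<exists>\<phi> G H S y. C2_derivs \<phi> G H \<and>
      compact S \<and> S \<subseteq> ball c R \<and> (\<forall>x. x \<notin> S \<longrightarrow> \<phi> x = 0) \<and> (\<forall>x. 0 \<le> \<phi> x) \<and>
      (\<forall>x\<in>ball c (R/2). 1 \<le> \<phi> x) \<and> ball y (\<epsilon>/4) \<subseteq> ball p (2 * \<epsilon>) \<inter> ball c R \<and>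
      (\<forall>x. - laplacian H x \<le> K / \<epsilon>\<^sup>2 * \<phi> x * indicator (ball y (\<epsilon>/4)) x) \<and>
      (\<forall>x\<in>ball y (\<epsilon>/4). \<phi> x * \<epsilon> ^ (DIM('e) - 1) \<le> K) \<and>
      (\<integral>x. \<phi> x \<partial>lborel) \<le> K"
proof -
  define N where "N = real DIM('e)"
  define k where "k = (N - 2) / 2"
  have k: "0 < k" "3 \<le> N" using dim by (auto simp: k_def N_def)
  define w where "w = 12 * k * R * (80 * R\<^sup>2) powr (- N / 2)"
  have w: "0 < w" using k R by (simp add: w_def)
  define \<Lambda> where "\<Lambda> = 3 / w"
  have \<Lambda>: "0 < \<Lambda>" using w by (simp add: \<Lambda>_def)
  define B where "B = 32 * (4 + N) * k * 3 powr (k + 1)"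
  have B: "0 \<le> B" using k by (simp add: B_def)
  define K1 where "K1 = max (4 * B) (6 * \<Lambda> * 3 powr k)"
  have K1: "4 * B \<le> K1" "6 * \<Lambda> * 3 powr k \<le> K1" by (auto simp: K1_def)
  have K1_pos: "0 < K1" using K1(2) \<Lambda> by (smt (verit) mult_pos_pos powr_gt_zero)
  define M where "M = 3 * R * K1\<^sup>2 * unit_ball_vol N"
  have M: "0 \<le> M" using R by (simp add: M_def N_def)
  define K where "K = K1 + M"
  have K: "K1 \<le> K" "M \<le> K" "0 < K" using M K1_pos by (auto simp: K_def)
  define \<epsilon>0 where "\<epsilon>0 = min (R / 4) (min 1 (\<Lambda> / 4))"
  show thesis
  proof (rule that[of K \<epsilon>0])
    show "0 < \<epsilon>0" using R \<Lambda> by (simp add: \<epsilon>0_def)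
    fix \<epsilon> :: real assume \<epsilon>: "0 < \<epsilon>" "\<epsilon> < \<epsilon>0"
    then have \<epsilon>': "\<epsilon> \<le> R / 4" "\<epsilon> \<le> 1" "\<epsilon> \<le> \<Lambda> / 4" by (auto simp: \<epsilon>0_def)
    define E where "E = \<epsilon> ^ (DIM('e) - 1)"
    have E: "0 < E" using \<epsilon> by (simp add: E_def)
    have eE: "\<epsilon> ^ DIM('e) = \<epsilon> * E" using dim by (simp add: E_def flip: power_Suc)
    define \<mu> where "\<mu> = \<Lambda> / E"
    have \<mu>: "4 \<le> \<mu>"
    proof -
      have "E \<le> \<epsilon> ^ 1" unfolding E_def using \<epsilon> \<epsilon>' dim by (intro power_decreasing) auto
      then have "4 * E \<le> \<Lambda>" using \<epsilon>' by simp
      then show ?thesis using E by (simp add: \<mu>_def field_simps)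
    qed
    obtain W G H y where W: "C2_derivs W G H"
      and y: "ball y (\<epsilon>/4) \<subseteq> ball p (2 * \<epsilon>)"
      and Wout: "\<And>x. R \<le> norm (x - c) \<Longrightarrow> W x \<le> 0"
      and lap0: "\<And>x. norm (x - c) < R \<Longrightarrow> x \<notin> ball y (\<epsilon>/4) \<Longrightarrow> laplacian H x = 0"
      and lapn: "\<And>x. x \<in> ball y (\<epsilon>/4) \<Longrightarrow> - laplacian H x \<le> B / \<epsilon>\<^sup>2"
      and Wn: "\<And>x. x \<in> ball y (\<epsilon>/4) \<Longrightarrow> 3/4 \<le> W x \<and> W x \<le> 3 powr k"
      and near: "\<And>x. x \<in> ball y (\<epsilon>/4) \<Longrightarrow> norm (x - c) < R \<and> R\<^sup>2 - (norm (x - c))\<^sup>2 \<le> 3 * R * \<epsilon>"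
      and Wc: "\<And>x. norm (x - c) < R / 2 \<Longrightarrow> w * E \<le> W x"
      using regularized_green_function[OF dim R \<epsilon>(1) \<epsilon>'(1)]
      unfolding N_def[symmetric] k_def[symmetric] w_def[symmetric] B_def[symmetric] E_def[symmetric] by blast
    define t where "t = (\<lambda>x. \<mu> * (W x - 0) + (- 1))"
    have c0: "C2_derivs (\<lambda>x. 0 :: real) (\<lambda>x. 0) (\<lambda>b x. 0 :: 'e)" by (simp add: C2_derivs_def GDERIV_const)
    define Gt Ht where "Gt = (\<lambda>x. \<mu> *\<^sub>R (G x - 0))" and "Ht = (\<lambda>b x. \<mu> *\<^sub>R (H b x - 0))"
    have t: "C2_derivs t Gt Ht" unfolding t_def Gt_def Ht_def by (rule C2_derivs_affine_diff[OF W c0])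
    have laplacian_t: "laplacian Ht x = \<mu> * laplacian H x" for x
      unfolding Ht_def laplacian_diff by (simp add: laplacian_def)
    define \<phi> where "\<phi> = (\<lambda>x. hinge (t x))"
    define G\<phi> where "G\<phi> = (\<lambda>x. hinge' (t x) *\<^sub>R Gt x)"
    define H\<phi> where "H\<phi> = (\<lambda>b x. (hinge'' (t x) * (Gt x \<bullet> b)) *\<^sub>R Gt x + hinge' (t x) *\<^sub>R Ht b x)"
    have \<phi>: "C2_derivs \<phi> G\<phi> H\<phi>" unfolding \<phi>_def G\<phi>_def H\<phi>_def
      by (rule C2_derivs_compose[OF t DERIV_hinge DERIV_hinge' continuous_hinge''])
    have laplacian_\<phi>: "laplacian H\<phi> x = hinge'' (t x) * (Gt x \<bullet> Gt x) + hinge' (t x) * (\<mu> * laplacian H x)" for x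
      unfolding H\<phi>_def laplacian_compose laplacian_t ..
    have t_out: "t x < 0" if "R \<le> norm (x - c)" for x
    proof -
      have "\<mu> * W x \<le> 0" using Wout[OF that] \<mu> by (intro mult_nonneg_nonpos) auto
      then show ?thesis by (simp add: t_def)
    qed
    have t_near: "2 \<le> t x" "\<mu> / 4 \<le> t x - 1" "t x \<le> \<mu> * 3 powr k" if "x \<in> ball y (\<epsilon>/4)" for x
    proof -
      have "\<mu> * (3/4) \<le> \<mu> * W x" "\<mu> * W x \<le> \<mu> * 3 powr k"
        using Wn[OF that] \<mu> by (intro mult_left_mono; simp)+
      then show "2 \<le> t x" "\<mu> / 4 \<le> t x - 1" "t x \<le> \<mu> * 3 powr k"
        using \<mu> unfolding t_def diff_zero by - linarith+
    qed
    \<comment> \<open>On the sphere \<open>t\<close> is negative, so this closed set stays inside the open ball.\<close>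
    define S where "S = {x \<in> cball c R. 0 \<le> t x}"
    have S: "compact S"
    proof -
      have "closed {x. 0 \<le> t x}" using C2_derivsD(4)[OF t, of UNIV] by (intro closed_Collect_le continuous_intros) auto
      then have "compact (cball c R \<inter> {x. 0 \<le> t x})" by (intro compact_Int_closed) auto
      moreover have "cball c R \<inter> {x. 0 \<le> t x} = S" by (auto simp: S_def)
      ultimately show ?thesis by simp
    qed
    have SR: "S \<subseteq> ball c R"
    proof
      fix x assume "x \<in> S"
      then show "x \<in> ball c R" using t_out[of x] by (force simp: S_def dist_norm norm_minus_commute)
    qed
    have out: "\<phi> x = 0" if "x \<notin> S" for x
    proof -
      have "t x \<le> 0" using that t_out[of x] by (force simp: S_def dist_norm norm_minus_commute)
      then show ?thesis by (simp add: \<phi>_def hinge_eq)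
    qed
    have nonneg: "0 \<le> \<phi> x" for x by (simp add: \<phi>_def hinge_nonneg)
    have lapb: "- laplacian H\<phi> x \<le> K1 / \<epsilon>\<^sup>2 * \<phi> x * indicator (ball y (\<epsilon>/4)) x" for x
    proof -
      have h'': "0 \<le> hinge'' (t x) * (Gt x \<bullet> Gt x)" by (intro mult_nonneg_nonneg hinge''_nonneg) auto
      show ?thesis
      proof (cases "x \<in> ball y (\<epsilon>/4)")
        case True
        have "- laplacian H\<phi> x \<le> hinge' (t x) * (\<mu> * - laplacian H x)" using h'' by (simp add: laplacian_\<phi>)
        also have "\<dots> \<le> hinge' (t x) * (\<mu> * (B / \<epsilon>\<^sup>2))"
          using lapn[OF True] \<mu> hinge'_bounds(1) by (intro mult_left_mono) auto
        also have "\<dots> \<le> 6 * (\<mu> * (B / \<epsilon>\<^sup>2))"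
          using hinge'_bounds(2) \<mu> B by (intro mult_right_mono) auto
        also have "\<dots> = 4 * B / \<epsilon>\<^sup>2 * (6 * (\<mu> / 4))" by simp
        also have "\<dots> \<le> K1 / \<epsilon>\<^sup>2 * \<phi> x"
          unfolding \<phi>_def hinge_eq(2)[OF t_near(1)[OF True]] using t_near(2)[OF True] K1 B \<mu> K1_pos
          by (intro mult_mono divide_right_mono) auto
        finally show ?thesis using True by simp
      next
        case False
        have "hinge' (t x) * (\<mu> * laplacian H x) = 0"
        proof (cases "norm (x - c) < R")
          case True
          then show ?thesis using lap0[OF True False] by simp
        next
          case False
          then show ?thesis using t_out[of x] by (simp add: hinge'_eq)
        qed
        then have "- laplacian H\<phi> x \<le> 0" unfolding laplacian_\<phi> using h'' by linarith
        then show ?thesis using False by simp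
      qed
    qed
    have \<phi>n: "\<phi> x * E \<le> K1" if "x \<in> ball y (\<epsilon>/4)" for x
    proof -
      have "\<phi> x \<le> 6 * t x" unfolding \<phi>_def using t_near(1)[OF that] by (intro hinge_le) auto
      also have "\<dots> \<le> 6 * (\<mu> * 3 powr k)" using t_near(3)[OF that] by simp
      finally have "\<phi> x * E \<le> 6 * (\<mu> * 3 powr k) * E" using E by (intro mult_right_mono) auto
      also have "\<dots> = 6 * \<Lambda> * 3 powr k" using E by (simp add: \<mu>_def)
      finally show ?thesis using K1 by simp
    qed
    \<comment> \<open>Mass of \<open>- \<Delta>\<phi>\<close> of order \<open>1 / \<epsilon>\<close>, weighted with a paraboloid of order \<open>\<epsilon>\<close>.\<close>
    have int: "(\<integral>x. \<phi> x \<partial>lborel) \<le> M"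
    proof -
      have I: "0 \<le> (\<integral>x. \<phi> x \<partial>lborel)" using nonneg by simp
      have "(\<integral>x. \<phi> x \<partial>lborel) \<le> 2 * DIM('e) * (\<integral>x. \<phi> x \<partial>lborel)"
        using dim mult_right_mono[OF _ I, of 1 "2 * real DIM('e)"] by simp
      also have "\<dots> = (\<integral>x. - laplacian H\<phi> x * (R\<^sup>2 - (norm (x - c))\<^sup>2) \<partial>lborel)"
        by (rule integral_laplacian_paraboloid[OF \<phi> S out])
      also have "\<dots> \<le> (\<integral>x. (3 * R * K1\<^sup>2 / \<epsilon> ^ DIM('e)) * indicator (ball y (\<epsilon>/4)) x \<partial>lborel)"
      proof (rule integral_mono)
        show "integrable lborel (\<lambda>x. - laplacian H\<phi> x * (R\<^sup>2 - (norm (x - c))\<^sup>2))"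
          by (rule integrable_compact_support[OF _ S])
            (auto intro!: continuous_intros continuous_on_laplacian[OF \<phi>] simp: laplacian_zero_outside[OF \<phi> compact_imp_closed[OF S] out])
        show "integrable lborel (\<lambda>x. (3 * R * K1\<^sup>2 / \<epsilon> ^ DIM('e)) * indicator (ball y (\<epsilon>/4)) x)"
          using emeasure_lborel_ball_finite[of y "\<epsilon>/4"] by (intro integrable_mult_right integrable_real_indicator) auto
        fix x :: 'e
        show "- laplacian H\<phi> x * (R\<^sup>2 - (norm (x - c))\<^sup>2) \<le> (3 * R * K1\<^sup>2 / \<epsilon> ^ DIM('e)) * indicator (ball y (\<epsilon>/4)) x"
        proof (cases "norm (x - c) < R")
          case False
          then have "x \<notin> S" using SR by (auto simp: dist_norm norm_minus_commute)
          then show ?thesis using laplacian_zero_outside[OF \<phi> compact_imp_closed[OF S] out] R \<epsilon> by simp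
        next
          case True
          have pos: "0 \<le> R\<^sup>2 - (norm (x - c))\<^sup>2" using True by (simp add: power_mono)
          show ?thesis
          proof (cases "x \<in> ball y (\<epsilon>/4)")
            case x: True
            have "\<phi> x \<le> K1 / E" using \<phi>n[OF x] E by (simp add: field_simps)
            then have "K1 / \<epsilon>\<^sup>2 * \<phi> x \<le> K1 / \<epsilon>\<^sup>2 * (K1 / E)" using K1_pos by (intro mult_left_mono) auto
            then have "- laplacian H\<phi> x \<le> K1 / \<epsilon>\<^sup>2 * (K1 / E)" using lapb[of x] x by simp
            then have "- laplacian H\<phi> x * (R\<^sup>2 - (norm (x - c))\<^sup>2) \<le> (K1 / \<epsilon>\<^sup>2 * (K1 / E)) * (3 * R * \<epsilon>)"
              using near[OF x] pos K1_pos E by (intro mult_mono) auto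
            also have "\<dots> = 3 * R * K1\<^sup>2 / \<epsilon> ^ DIM('e)"
              unfolding eE using \<epsilon> by (simp add: power2_eq_square)
            finally show ?thesis using x by simp
          next
            case x: False
            have "- laplacian H\<phi> x \<le> 0" using lapb[of x] x by simp
            then have "- laplacian H\<phi> x * (R\<^sup>2 - (norm (x - c))\<^sup>2) \<le> 0" using pos by (intro mult_nonpos_nonneg)
            then show ?thesis using x by simp
          qed
        qed
      qed
      also have "\<dots> = (3 * R * K1\<^sup>2 / \<epsilon> ^ DIM('e)) * measure lborel (ball y (\<epsilon>/4))" by simp
      also have "\<dots> = (3 * R * K1\<^sup>2 / \<epsilon> ^ DIM('e)) * (unit_ball_vol N * (\<epsilon>/4) ^ DIM('e))"
        using \<epsilon> by (simp add: content_ball N_def)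
      also have "\<dots> = M / 4 ^ DIM('e)" using \<epsilon> by (simp add: M_def power_divide)
      also have "\<dots> \<le> M" using M by (simp add: divide_le_eq mult_le_cancel_left1)
      finally show ?thesis .
    qed
    show "\<exists>\<phi> G H S y. C2_derivs \<phi> G H \<and>
      compact S \<and> S \<subseteq> ball c R \<and> (\<forall>x. x \<notin> S \<longrightarrow> \<phi> x = 0) \<and> (\<forall>x. 0 \<le> \<phi> x) \<and>
      (\<forall>x\<in>ball c (R/2). 1 \<le> \<phi> x) \<and> ball y (\<epsilon>/4) \<subseteq> ball p (2 * \<epsilon>) \<inter> ball c R \<and>
      (\<forall>x. - laplacian H x \<le> K / \<epsilon>\<^sup>2 * \<phi> x * indicator (ball y (\<epsilon>/4)) x) \<and>
      (\<forall>x\<in>ball y (\<epsilon>/4). \<phi> x * \<epsilon> ^ (DIM('e) - 1) \<le> K) \<and>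
      (\<integral>x. \<phi> x \<partial>lborel) \<le> K"
    proof (intro exI[of _ \<phi>] exI[of _ G\<phi>] exI[of _ H\<phi>] exI[of _ S] exI[of _ y] conjI ballI allI impI)
      show "1 \<le> \<phi> x" if "x \<in> ball c (R/2)" for x
      proof -
        have "w * E \<le> W x" using that by (intro Wc) (simp add: dist_norm norm_minus_commute)
        then have "\<mu> * (w * E) \<le> \<mu> * W x" using \<mu> by (intro mult_left_mono) auto
        moreover have "\<mu> * (w * E) = 3" using E w by (simp add: \<mu>_def \<Lambda>_def)
        ultimately have "2 \<le> t x" by (simp add: t_def)
        then show ?thesis by (simp add: \<phi>_def hinge_eq)
      qed
      show "ball y (\<epsilon>/4) \<subseteq> ball p (2 * \<epsilon>) \<inter> ball c R"
      proof
        fix x assume x: "x \<in> ball y (\<epsilon>/4)"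
        then show "x \<in> ball p (2 * \<epsilon>) \<inter> ball c R"
          using subsetD[OF y x] near[OF x] by (simp add: dist_norm norm_minus_commute[of c x])
      qed
      show "- laplacian H\<phi> x \<le> K / \<epsilon>\<^sup>2 * \<phi> x * indicator (ball y (\<epsilon>/4)) x" for x
      proof -
        have "K1 / \<epsilon>\<^sup>2 * \<phi> x * indicator (ball y (\<epsilon>/4)) x \<le> K / \<epsilon>\<^sup>2 * \<phi> x * indicator (ball y (\<epsilon>/4)) x"
          using K nonneg[of x] by (intro mult_right_mono divide_right_mono) auto
        then show ?thesis using lapb[of x] by linarith
      qed
      show "\<phi> x * \<epsilon> ^ (DIM('e) - 1) \<le> K" if "x \<in> ball y (\<epsilon>/4)" for x
        using \<phi>n[OF that] K by (simp add: E_def)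
      show "(\<integral>x. \<phi> x \<partial>lborel) \<le> K" using int K by simp
    qed (use \<phi> S SR out nonneg in auto)
  qed (use K in auto)
qed

section \<open>Weak solutions tested with products\<close>

lemma GDERIV_product:
  fixes f :: "'e::euclidean_space \<Rightarrow> real" and h :: "real \<Rightarrow> real"
  assumes "GDERIV f (fst z) :> D" "DERIV h (snd z) :> h'"
  shows "GDERIV (\<lambda>z. f (fst z) * h (snd z)) z :> (h (snd z) *\<^sub>R D, f (fst z) * h')"
proof -
  have 1: "((\<lambda>z. f (fst z)) has_derivative (\<lambda>v. fst v \<bullet> D)) (at z)"
    using has_derivative_compose[OF has_derivative_fst[OF has_derivative_ident] assms(1)[unfolded gderiv_def]] .
  have 2: "((\<lambda>z. h (snd z)) has_derivative (\<lambda>v. h' * snd v)) (at z)"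
    using has_derivative_compose[OF has_derivative_snd[OF has_derivative_ident] assms(2)[unfolded has_field_derivative_def]] .
  show ?thesis
    unfolding gderiv_def
    by (rule has_derivative_eq_rhs[OF has_derivative_mult[OF 1 2]])
      (auto simp: fun_eq_iff inner_prod_def algebra_simps)
qed

lemma set_integrable_mult_compact_support:
  fixes w \<zeta> :: "'e::euclidean_space \<Rightarrow> real"
  assumes w: "w absolutely_integrable_on K" and K: "compact K" "K \<subseteq> Z"
    and \<zeta>: "continuous_on UNIV \<zeta>" "\<And>z. z \<notin> K \<Longrightarrow> \<zeta> z = 0"
  shows "set_integrable lebesgue Z (\<lambda>z. w z * \<zeta> z)"
proof -
  have "bounded (\<zeta> ` K)"
    using K(1) \<zeta>(1) by (meson compact_continuous_image compact_imp_bounded continuous_on_subset subset_UNIV)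
  then obtain B where B: "0 < B" "\<And>z. z \<in> K \<Longrightarrow> \<bar>\<zeta> z\<bar> \<le> B" unfolding bounded_pos by auto
  have m: "\<zeta> \<in> borel_measurable lebesgue"
    using \<zeta>(1) by (intro measurable_completion) (simp add: borel_measurable_continuous_onI)
  have w': "integrable lebesgue (\<lambda>z. indicator K z *\<^sub>R w z)" using w by (simp add: set_integrable_def)
  have "integrable lebesgue (\<lambda>z. \<zeta> z * (indicator K z *\<^sub>R w z))"
  proof (rule Bochner_Integration.integrable_bound)
    show "integrable lebesgue (\<lambda>z. B * (indicator K z *\<^sub>R w z))" using w' by simp
    show "(\<lambda>z. \<zeta> z * (indicator K z *\<^sub>R w z)) \<in> borel_measurable lebesgue"
      by (intro borel_measurable_times m borel_measurable_integrable[OF w'])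
    show "AE z in lebesgue. norm (\<zeta> z * (indicator K z *\<^sub>R w z)) \<le> norm (B * (indicator K z *\<^sub>R w z))"
      using B by (intro AE_I2) (auto simp: indicator_def abs_mult intro!: mult_right_mono)
  qed
  moreover have "(\<lambda>z. \<zeta> z * (indicator K z *\<^sub>R w z)) = (\<lambda>z. indicator Z z *\<^sub>R (w z * \<zeta> z))"
    using K(2) \<zeta>(2) by (auto simp: fun_eq_iff indicator_def)
  ultimately show ?thesis by (simp add: set_integrable_def)
qed

lemma interior_cylinder: "open \<Omega> \<Longrightarrow> interior (\<Omega> \<times> {0..}) = \<Omega> \<times> {0::real<..}"
  by (simp add: interior_Times interior_open)

text \<open>
  As \<open>\<psi>\<close> vanishes before a positive time, the test function has compact support in the open cylinder, and
  the initial datum drops out. The components of \<open>\<psi> t *\<^sub>R \<nabla>\<phi> x\<close> are then admissible test functions for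
  the weak gradient of \<open>u\<close>, which moves the remaining derivative from \<open>u\<close> to \<open>\<phi>\<close>.
\<close>

lemma weak_solution_product_test:
  fixes \<Omega> :: "'a::euclidean_space set" and \<psi> :: "real \<Rightarrow> real"
  assumes sol: "weak_solution \<Omega> V q u0 u" and \<Omega>: "open \<Omega>" and V: "L1_loc (\<Omega> \<times> {0..}) V"
    and \<phi>: "C2_derivs \<phi> G H" "compact S" "S \<subseteq> \<Omega>" "\<And>x. x \<notin> S \<Longrightarrow> \<phi> x = 0" "\<And>x. 0 \<le> \<phi> x"
    and \<psi>: "\<And>t. (\<psi> has_real_derivative \<psi>' t) (at t)" "continuous_on UNIV \<psi>'"
      "0 < a" "\<And>t. t \<notin> {a..T} \<Longrightarrow> \<psi> t = 0" "\<And>t. 0 \<le> \<psi> t"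
  defines "Z \<equiv> \<Omega> \<times> {0<..}"
  shows "set_integrable lebesgue Z (\<lambda>z. V z * u z powr q * (\<phi> (fst z) * \<psi> (snd z)))"
    and "set_integrable lebesgue Z (\<lambda>z. u z * (- laplacian H (fst z) * \<psi> (snd z) - \<phi> (fst z) * \<psi>' (snd z)))"
    and "(LINT z:Z|lebesgue. V z * u z powr q * (\<phi> (fst z) * \<psi> (snd z)))
       \<le> (LINT z:Z|lebesgue. u z * (- laplacian H (fst z) * \<psi> (snd z) - \<phi> (fst z) * \<psi>' (snd z)))"
proof -
  define K where "K = S \<times> {a..T}"
  have K: "compact K" "K \<subseteq> Z" "K \<subseteq> \<Omega> \<times> {0..}"
    using \<phi>(2,3) \<psi>(3) by (auto simp: K_def Z_def intro!: compact_Times)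
  obtain g where g: "W12_loc (\<Omega> \<times> {0..}) u g"
    and weak: "\<And>\<Theta>. lip_test (\<Omega> \<times> {0..}) \<Theta> \<Longrightarrow>
          (LINT z:Z|lebesgue. V z * u z powr q * \<Theta> z)
          \<le> (LINT z:Z|lebesgue. fst (g z) \<bullet> fst (gradient \<Theta> z))
            - (LINT z:Z|lebesgue. u z * snd (gradient \<Theta> z))
            - (LINT x:\<Omega>|lebesgue. u0 x * \<Theta> (x, 0))"
    using sol unfolding weak_solution_def Z_def by blast
  have hw: "has_weak_gradient Z u g" using g interior_cylinder[OF \<Omega>] by (simp add: W12_loc_def Z_def)
  have uK: "u absolutely_integrable_on K" and gK: "g absolutely_integrable_on K"
    using hw K unfolding has_weak_gradient_def L1_loc_def by auto
  have c\<psi>: "continuous_on A \<psi>" for A using \<psi>(1) by (meson DERIV_isCont continuous_at_imp_continuous_on)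
  have c\<psi>': "continuous_on A \<psi>'" for A using \<psi>(2) by (rule continuous_on_subset) simp
  have \<psi>'0: "\<psi>' t = 0" if "t \<notin> {a..T}" for t
    using GDERIV_zero_outside[of \<psi> t "\<psi>' t" "{a..T}"] \<psi>(1)[of t] \<psi>(4) that by simp
  have G0: "G x = 0" if "x \<notin> S" for x
    using GDERIV_zero_outside[OF C2_derivsD(1)[OF \<phi>(1)] compact_imp_closed[OF \<phi>(2)] \<phi>(4) that] .
  have lap0: "laplacian H x = 0" if "x \<notin> S" for x
    using laplacian_zero_outside[OF \<phi>(1) compact_imp_closed[OF \<phi>(2)] \<phi>(4) that] .
  have H0: "H b x = 0" if "x \<notin> S" "b \<in> Basis" for x b
    using GDERIV_zero_outside[OF C2_derivsD(2)[OF \<phi>(1) that(2)] compact_imp_closed[OF \<phi>(2)] _ that(1)] G0 by simp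
  have cc: "continuous_on UNIV (\<lambda>z::'a \<times> real. f (fst z))" if "continuous_on UNIV f" for f :: "'a \<Rightarrow> 'c::topological_space"
    by (rule continuous_on_compose2[OF that]) (auto intro: continuous_intros)
  have cc': "continuous_on UNIV (\<lambda>z::'a \<times> real. f (snd z))" if "continuous_on UNIV f" for f :: "real \<Rightarrow> 'c::topological_space"
    by (rule continuous_on_compose2[OF that]) (auto intro: continuous_intros)
  note conts = cc[OF C2_derivsD(4)[OF \<phi>(1)]] cc[OF C2_derivsD(5)[OF \<phi>(1)]] cc[OF continuous_on_laplacian[OF \<phi>(1)]]
    cc'[OF c\<psi>] cc'[OF c\<psi>']
  define \<Theta> where "\<Theta> = (\<lambda>z. \<phi> (fst z) * \<psi> (snd z))"
  define D\<Theta> where "D\<Theta> = (\<lambda>z. (\<psi> (snd z) *\<^sub>R G (fst z), \<phi> (fst z) * \<psi>' (snd z)))"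
  have D\<Theta>: "GDERIV \<Theta> z :> D\<Theta> z" for z
    unfolding \<Theta>_def D\<Theta>_def by (intro GDERIV_product C2_derivsD(1)[OF \<phi>(1)] \<psi>(1))
  have \<Theta>0: "\<Theta> z = 0" if "z \<notin> K" for z
    using that \<phi>(4)[of "fst z"] \<psi>(4)[of "snd z"] by (auto simp: \<Theta>_def K_def mem_Times_iff)
  have cD\<Theta>: "continuous_on UNIV D\<Theta>" unfolding D\<Theta>_def by (intro continuous_intros conts)
  have c\<Theta>: "continuous_on UNIV \<Theta>" unfolding \<Theta>_def by (intro continuous_intros conts)
  have "lip_test (\<Omega> \<times> {0..}) \<Theta>"
  proof -
    obtain L where "L-lipschitz_on UNIV \<Theta>"
      using compact_support_C1_lipschitz[OF D\<Theta> cD\<Theta> K(1) \<Theta>0] by metis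
    then have "L-lipschitz_on (\<Omega> \<times> {0..}) \<Theta>" by (rule lipschitz_on_subset) simp
    then show ?thesis
      unfolding lip_test_def
    proof (intro conjI exI[of _ L] exI[of _ K] ballI)
      show "0 \<le> \<Theta> z" for z using \<phi>(5) \<psi>(5) by (simp add: \<Theta>_def)
    qed (use K \<Theta>0 in auto)
  qed
  from weak[OF this] have main: "(LINT z:Z|lebesgue. V z * u z powr q * \<Theta> z)
      \<le> (LINT z:Z|lebesgue. fst (g z) \<bullet> (\<psi> (snd z) *\<^sub>R G (fst z)))
        - (LINT z:Z|lebesgue. u z * (\<phi> (fst z) * \<psi>' (snd z)))"
    using \<psi>(3,4) by (simp add: gradient_eq[OF D\<Theta>]) (simp add: D\<Theta>_def \<Theta>_def)
  have gb: "(\<lambda>z. fst (g z) \<bullet> b) absolutely_integrable_on K" for b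
  proof -
    have "integrable lebesgue (\<lambda>z. (indicator K z *\<^sub>R g z) \<bullet> (b, 0))"
      using gK unfolding set_integrable_def by (rule integrable_inner_left)
    then show ?thesis by (simp add: set_integrable_def inner_prod_def)
  qed
  have parts: "(LINT z:Z|lebesgue. (fst (g z) \<bullet> b) * (\<psi> (snd z) * (G (fst z) \<bullet> b)))
      = - (LINT z:Z|lebesgue. u z * (\<psi> (snd z) * (H b (fst z) \<bullet> b)))" if b: "b \<in> Basis" for b
  proof -
    define \<eta> where "\<eta> = (\<lambda>z. (G (fst z) \<bullet> b) * \<psi> (snd z))"
    define D\<eta> where "D\<eta> = (\<lambda>z. (\<psi> (snd z) *\<^sub>R H b (fst z), (G (fst z) \<bullet> b) * \<psi>' (snd z)))"
    have "\<forall>z. GDERIV \<eta> z :> D\<eta> z"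
      unfolding \<eta>_def D\<eta>_def by (intro allI GDERIV_product C2_derivsD(2)[OF \<phi>(1)] \<psi>(1) b)
    moreover have "continuous_on UNIV D\<eta>"
      unfolding D\<eta>_def by (intro continuous_intros conts cc[OF C2_derivsD(3)[OF \<phi>(1) b]])
    moreover have "\<forall>z. z \<notin> K \<longrightarrow> \<eta> z = 0"
      using G0 \<psi>(4) by (auto simp: \<eta>_def K_def mem_Times_iff)
    ultimately have "\<forall>b'\<in>Basis. (LINT z:Z|lebesgue. u z * (D\<eta> z \<bullet> b')) = - (LINT z:Z|lebesgue. (g z \<bullet> b') * \<eta> z)"
      using hw K unfolding has_weak_gradient_def by blast
    moreover have "(b, 0::real) \<in> Basis" using b by (simp add: Basis_prod_def)
    ultimately have "(LINT z:Z|lebesgue. u z * (D\<eta> z \<bullet> (b, 0))) = - (LINT z:Z|lebesgue. (g z \<bullet> (b, 0)) * \<eta> z)" by blast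
    then show ?thesis by (simp add: D\<eta>_def \<eta>_def inner_prod_def mult.commute mult.left_commute)
  qed
  have ig: "set_integrable lebesgue Z (\<lambda>z. (fst (g z) \<bullet> b) * (\<psi> (snd z) * (G (fst z) \<bullet> b)))" for b
    by (rule set_integrable_mult_compact_support[OF gb K(1,2)])
      (use G0 \<psi>(4) in \<open>auto simp: K_def mem_Times_iff intro!: continuous_intros conts\<close>)
  have iu: "set_integrable lebesgue Z (\<lambda>z. u z * (\<psi> (snd z) * (H b (fst z) \<bullet> b)))" if "b \<in> Basis" for b
    by (rule set_integrable_mult_compact_support[OF uK K(1,2)])
      (use H0 that \<psi>(4) in \<open>auto simp: K_def mem_Times_iff intro!: continuous_intros conts cc[OF C2_derivsD(3)[OF \<phi>(1) that]]\<close>)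
  have iu2: "set_integrable lebesgue Z (\<lambda>z. u z * (\<phi> (fst z) * \<psi>' (snd z)))"
    by (rule set_integrable_mult_compact_support[OF uK K(1,2)])
      (use \<phi>(4) \<psi>'0 in \<open>auto simp: K_def mem_Times_iff intro!: continuous_intros conts\<close>)
  have iu3: "set_integrable lebesgue Z (\<lambda>z. u z * (laplacian H (fst z) * \<psi> (snd z)))"
    by (rule set_integrable_mult_compact_support[OF uK K(1,2)])
      (use lap0 \<psi>(4) in \<open>auto simp: K_def mem_Times_iff intro!: continuous_intros conts\<close>)
  have "(LINT z:Z|lebesgue. fst (g z) \<bullet> (\<psi> (snd z) *\<^sub>R G (fst z)))
      = (LINT z:Z|lebesgue. (\<Sum>b\<in>Basis. (fst (g z) \<bullet> b) * (\<psi> (snd z) * (G (fst z) \<bullet> b))))"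
    by (simp add: euclidean_inner[of "fst (g _)" "G (fst _)"] sum_distrib_left mult.left_commute)
  also have "\<dots> = (\<Sum>b\<in>Basis. (LINT z:Z|lebesgue. (fst (g z) \<bullet> b) * (\<psi> (snd z) * (G (fst z) \<bullet> b))))"
    unfolding set_lebesgue_integral_def scaleR_sum_right
    by (rule Bochner_Integration.integral_sum) (use ig in \<open>simp add: set_integrable_def\<close>)
  also have "\<dots> = - (\<Sum>b\<in>Basis. (LINT z:Z|lebesgue. u z * (\<psi> (snd z) * (H b (fst z) \<bullet> b))))"
    by (simp add: parts sum_negf)
  also have "(\<Sum>b\<in>Basis. (LINT z:Z|lebesgue. u z * (\<psi> (snd z) * (H b (fst z) \<bullet> b))))
      = (LINT z:Z|lebesgue. (\<Sum>b\<in>Basis. u z * (\<psi> (snd z) * (H b (fst z) \<bullet> b))))"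
    unfolding set_lebesgue_integral_def scaleR_sum_right
    by (rule Bochner_Integration.integral_sum[symmetric]) (use iu in \<open>simp add: set_integrable_def\<close>)
  also have "\<dots> = (LINT z:Z|lebesgue. u z * (laplacian H (fst z) * \<psi> (snd z)))"
    by (simp add: laplacian_def sum_distrib_left sum_distrib_right mult.commute mult.left_commute)
  finally have div: "(LINT z:Z|lebesgue. fst (g z) \<bullet> (\<psi> (snd z) *\<^sub>R G (fst z)))
      = - (LINT z:Z|lebesgue. u z * (laplacian H (fst z) * \<psi> (snd z)))" .
  have split: "(\<lambda>z. u z * (- laplacian H (fst z) * \<psi> (snd z) - \<phi> (fst z) * \<psi>' (snd z)))
      = (\<lambda>z. - (u z * (laplacian H (fst z) * \<psi> (snd z))) - u z * (\<phi> (fst z) * \<psi>' (snd z)))"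
    by (simp add: fun_eq_iff algebra_simps)
  have iu3': "set_integrable lebesgue Z (\<lambda>z. - (u z * (laplacian H (fst z) * \<psi> (snd z))))"
    using set_integrable_mult_right[OF iu3, of "-1"] by simp
  show "set_integrable lebesgue Z (\<lambda>z. u z * (- laplacian H (fst z) * \<psi> (snd z) - \<phi> (fst z) * \<psi>' (snd z)))"
    unfolding split by (intro set_integral_diff iu3' iu2)
  show "(LINT z:Z|lebesgue. V z * u z powr q * (\<phi> (fst z) * \<psi> (snd z)))
       \<le> (LINT z:Z|lebesgue. u z * (- laplacian H (fst z) * \<psi> (snd z) - \<phi> (fst z) * \<psi>' (snd z)))"
    using main unfolding split div set_integral_diff(2)[OF iu3' iu2] set_integral_uminus[OF iu3] \<Theta>_def .
  have VK: "(\<lambda>z. V z * u z powr q) absolutely_integrable_on K"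
  proof -
    have Ks: "K \<in> sets lebesgue" using K(1) by (simp add: compact_imp_closed)
    have *: "u \<in> borel_measurable (lebesgue_on K)" "set_integrable lebesgue K (\<lambda>z. V z * norm (u z) powr q)"
      using sol K unfolding weak_solution_def Lp_loc_def by auto
    have "V absolutely_integrable_on K" using V K unfolding L1_loc_def by auto
    then have "integrable (lebesgue_on K) V" using Ks by (simp add: set_integrable_def integrable_restrict_space)
    then have "(\<lambda>z. V z * u z powr q) \<in> borel_measurable (lebesgue_on K)"
      using *(1) by measurable
    then have m: "(\<lambda>z. indicator K z *\<^sub>R (V z * u z powr q)) \<in> borel_measurable lebesgue"
      using Ks by (simp add: borel_measurable_restrict_space_iff)
    have "AE z in lebesgue. z \<in> Z \<longrightarrow> 0 \<le> u z" using sol by (simp add: weak_solution_def Z_def)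
    then have "AE z in lebesgue. indicator K z *\<^sub>R (V z * norm (u z) powr q) = indicator K z *\<^sub>R (V z * u z powr q)"
      by eventually_elim (use K(2) in \<open>auto simp: indicator_def\<close>)
    then show ?thesis
      using *(2) m unfolding set_integrable_def
      by (subst integrable_cong_AE[symmetric]) (auto dest: borel_measurable_integrable)
  qed
  show "set_integrable lebesgue Z (\<lambda>z. V z * u z powr q * (\<phi> (fst z) * \<psi> (snd z)))"
    using set_integrable_mult_compact_support[OF VK K(1,2) c\<Theta> \<Theta>0] by (simp add: \<Theta>_def)
qed

text \<open>
  A replacement for Young's inequality. If \<open>u \<le> m\<close>, the product is at most \<open>m * A\<close>; if \<open>u \<ge> m\<close>, then
  \<open>v * u powr (q - 1)\<close> is large enough to absorb it.
\<close>

lemma absorb_power: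
  fixes u v A \<Lambda> m \<phi> q :: real
  assumes "0 \<le> u" "0 \<le> v" "0 \<le> m" "0 \<le> A" "0 \<le> \<phi>" "A \<le> \<Lambda> * \<phi>" "4 * \<Lambda> \<le> v * m powr (q - 1)" "1 < q"
  shows "u * A \<le> 1/4 * (v * u powr q * \<phi>) + m * A"
proof (cases "u \<le> m")
  case True
  then have "u * A \<le> m * A" using assms by (intro mult_right_mono)
  moreover have "0 \<le> v * u powr q * \<phi>" using assms by simp
  ultimately show ?thesis by simp
next
  case False
  then have u: "0 < u" "m \<le> u" using assms by auto
  have "4 * \<Lambda> \<le> v * u powr (q - 1)"
    using assms u mult_left_mono[OF powr_mono2[of "q - 1" m u], of v] by auto
  then have "4 * (u * (\<Lambda> * \<phi>)) \<le> u * \<phi> * (v * u powr (q - 1))"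
    using mult_left_mono[of "4 * \<Lambda>" "v * u powr (q - 1)" "u * \<phi>"] u assms by (simp add: mult_ac)
  also have "\<dots> = v * u powr q * \<phi>"
    using u powr_mult_base[of u "q - 1"] by (simp add: mult_ac)
  finally have "4 * (u * (\<Lambda> * \<phi>)) \<le> v * u powr q * \<phi>" .
  moreover have "u * A \<le> u * (\<Lambda> * \<phi>)" using assms by (intro mult_left_mono)
  moreover have "0 \<le> m * A" using assms by simp
  ultimately show ?thesis by linarith
qed

lemma integral_lborel_product:
  fixes e :: "'a::euclidean_space \<Rightarrow> real" and \<tau> :: "real \<Rightarrow> real"
  assumes e: "integrable lborel e" "\<And>x. 0 \<le> e x" and \<tau>: "integrable lborel \<tau>" "\<And>x. 0 \<le> \<tau> x"
  shows "integrable lborel (\<lambda>z. e (fst z) * \<tau> (snd z))" (is ?I)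
    and "(\<integral>z. e (fst z) * \<tau> (snd z) \<partial>lborel) = (\<integral>x. e x \<partial>lborel) * (\<integral>t. \<tau> t \<partial>lborel)"
proof -
  have 1: "(\<lambda>(x, t). e x * \<tau> t) = (\<lambda>z. e (fst z) * \<tau> (snd z))" by auto
  have I: "integrable (lborel \<Otimes>\<^sub>M lborel) (\<lambda>(x, t). e x * \<tau> t)"
  proof (rule lborel_pair.Fubini_integrable)
    show "(\<lambda>(x, t). e x * \<tau> t) \<in> borel_measurable (lborel \<Otimes>\<^sub>M lborel)"
      using borel_measurable_integrable[OF e(1)] borel_measurable_integrable[OF \<tau>(1)] by measurable
    show "integrable lborel (\<lambda>x. \<integral>t. norm (case (x, t) of (x, t) \<Rightarrow> e x * \<tau> t) \<partial>lborel)"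
      using e \<tau> by (simp add: abs_mult)
    show "AE x in lborel. integrable lborel (\<lambda>t. case (x, t) of (x, t) \<Rightarrow> e x * \<tau> t)"
      using \<tau>(1) by simp
  qed
  then show ?I by (simp add: lborel_prod 1)
  have "(\<integral>z. e (fst z) * \<tau> (snd z) \<partial>lborel) = (\<integral>z. (\<lambda>(x, t). e x * \<tau> t) z \<partial>(lborel \<Otimes>\<^sub>M lborel))"
    by (simp add: lborel_prod 1)
  also have "\<dots> = (\<integral>x. \<integral>t. e x * \<tau> t \<partial>lborel \<partial>lborel)"
    using lborel_pair.integral_fst'[OF I] by simp
  finally show "(\<integral>z. e (fst z) * \<tau> (snd z) \<partial>lborel) = (\<integral>x. e x \<partial>lborel) * (\<integral>t. \<tau> t \<partial>lborel)" by simp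
qed

text \<open>
  The product of a smooth step, which rises after time \<open>a\<close>, with the \<open>s\<close>-th power of the positive part
  of \<open>1 - t / T\<close>. The rise contributes to \<open>- \<psi>'\<close> with a favourable sign, so only the slow decay
  enters the upper bound for \<open>- \<psi>'\<close>. The factor \<open>\<omega>\<close> is the value of the step.
\<close>

lemma time_cutoff:
  fixes a T :: real and s :: nat
  assumes a: "0 < a" and T: "0 < T" and s: "2 \<le> s"
  obtains \<psi> \<psi>' where "\<And>t. (\<psi> has_real_derivative \<psi>' t) (at t)" "continuous_on UNIV \<psi>'"
    "\<And>t. t \<notin> {a<..<T} \<Longrightarrow> \<psi> t = 0" "\<And>t. 0 \<le> \<psi> t" "\<And>t. \<psi> t \<le> 1"
    "\<And>t. 2 * a \<le> t \<Longrightarrow> 2 * t \<le> T \<Longrightarrow> (1/2) ^ Suc s \<le> \<psi> t"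
    "\<And>t. t < T \<Longrightarrow> \<exists>\<omega>. 0 \<le> \<omega> \<and> \<omega> \<le> 1 \<and> \<psi> t = \<omega> * (1 - t / T) ^ s \<and>
        (t \<le> 0 \<longrightarrow> \<omega> = 0) \<and> - \<psi>' t \<le> real s / T * (1 - t / T) ^ (s - 1) * \<omega>"
    "\<And>t. T \<le> t \<Longrightarrow> \<psi>' t = 0"
proof -
  obtain n where n: "s = Suc (Suc n)" using s by (metis Suc_le_D numeral_2_eq_2 Suc_le_mono)
  define \<omega> where "\<omega> = (\<lambda>t. hinge' (t / a - 1) / 6)"
  define \<theta> where "\<theta> = (\<lambda>t. max 0 (1 - t / T))"
  define \<psi> where "\<psi> = (\<lambda>t. \<omega> t * \<theta> t ^ s)"
  define \<psi>' where "\<psi>' = (\<lambda>t. hinge'' (t / a - 1) / (6 * a) * \<theta> t ^ s - real s / T * \<theta> t ^ (s - 1) * \<omega> t)"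
  have \<omega>: "0 \<le> \<omega> t" "\<omega> t \<le> 1" for t using hinge'_bounds[of "t / a - 1"] by (auto simp: \<omega>_def)
  have \<omega>0: "\<omega> t = 0" if "t \<le> a" for t using that a by (simp add: \<omega>_def hinge'_eq)
  have \<theta>: "0 \<le> \<theta> t" for t by (simp add: \<theta>_def)
  have \<theta>1: "\<theta> t \<le> 1" if "0 \<le> t" for t using that T by (simp add: \<theta>_def)
  have \<theta>0: "\<theta> t = 0" if "T \<le> t" for t using that T by (simp add: \<theta>_def)
  have D\<theta>: "((\<lambda>t. \<theta> t ^ s) has_real_derivative real s * \<theta> t ^ (s - 1) * - (1 / T)) (at t)" for t
  proof -
    have "((\<lambda>t. 1 - t / T) has_real_derivative - (1 / T)) (at t)"
      using T by (auto intro!: derivative_eq_intros)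
    from DERIV_chain2[OF DERIV_pos_part_power[of n] this] show ?thesis by (simp add: \<theta>_def n)
  qed
  have D\<omega>: "(\<omega> has_real_derivative hinge'' (t / a - 1) / (6 * a)) (at t)" for t
  proof -
    have "((\<lambda>t. t / a - 1) has_real_derivative 1 / a) (at t)"
      using a by (auto intro!: derivative_eq_intros)
    from DERIV_cdivide[OF DERIV_chain2[OF DERIV_hinge' this], of 6] show ?thesis
      using a by (simp add: \<omega>_def mult.commute)
  qed
  have D: "(\<psi> has_real_derivative \<psi>' t) (at t)" for t
    unfolding \<psi>_def \<psi>'_def using DERIV_mult[OF D\<omega> D\<theta>, of t] by simp
  have ch: "continuous_on UNIV hinge'" using DERIV_hinge' by (meson DERIV_isCont continuous_at_imp_continuous_on)
  have C: "continuous_on UNIV \<psi>'"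
    unfolding \<psi>'_def \<omega>_def \<theta>_def using a T
    by (intro continuous_intros continuous_on_compose2[OF continuous_hinge''] continuous_on_compose2[OF ch]) auto
  show thesis
  proof (rule that[OF D C])
    show "\<psi> t = 0" if "t \<notin> {a<..<T}" for t using that \<omega>0[of t] \<theta>0[of t] n by (auto simp: \<psi>_def)
    show "0 \<le> \<psi> t" for t using \<omega> \<theta> by (simp add: \<psi>_def)
    show "\<psi> t \<le> 1" for t
    proof (cases "0 \<le> t")
      case True
      then have "\<omega> t * \<theta> t ^ s \<le> 1 * 1" using \<omega> \<theta> \<theta>1 by (intro mult_mono power_le_one) auto
      then show ?thesis by (simp add: \<psi>_def)
    next
      case False
      then show ?thesis using \<omega>0[of t] a by (simp add: \<psi>_def)
    qed
    show "(1/2) ^ Suc s \<le> \<psi> t" if "2 * a \<le> t" "2 * t \<le> T" for t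
    proof -
      have "hinge' 1 \<le> hinge' (t / a - 1)" using that a by (intro hinge'_mono) (simp add: field_simps)
      moreover have "hinge' 1 = 3" by (simp add: hinge'_def)
      ultimately have "1/2 \<le> \<omega> t" by (simp add: \<omega>_def)
      moreover have "1/2 \<le> \<theta> t" using that T by (simp add: \<theta>_def field_simps)
      ultimately have "(1/2) * (1/2) ^ s \<le> \<omega> t * \<theta> t ^ s" by (intro mult_mono power_mono) auto
      then show ?thesis by (simp add: \<psi>_def)
    qed
    show "\<exists>\<omega>. 0 \<le> \<omega> \<and> \<omega> \<le> 1 \<and> \<psi> t = \<omega> * (1 - t / T) ^ s \<and>
        (t \<le> 0 \<longrightarrow> \<omega> = 0) \<and> - \<psi>' t \<le> real s / T * (1 - t / T) ^ (s - 1) * \<omega>" if "t < T" for t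
    proof (intro exI[of _ "\<omega> t"] conjI impI)
      have \<theta>t: "\<theta> t = 1 - t / T" using that T by (simp add: \<theta>_def max_def field_simps)
      show "\<psi> t = \<omega> t * (1 - t / T) ^ s" by (simp add: \<psi>_def \<theta>t)
      have "0 \<le> hinge'' (t / a - 1) / (6 * a) * \<theta> t ^ s" using hinge''_nonneg a \<theta> by simp
      then show "- \<psi>' t \<le> real s / T * (1 - t / T) ^ (s - 1) * \<omega> t" by (simp add: \<psi>'_def \<theta>t)
      show "\<omega> t = 0" if "t \<le> 0" using that a by (intro \<omega>0) simp
    qed (use \<omega> in auto)
    show "\<psi>' t = 0" if "T \<le> t" for t using \<theta>0[OF that] n by (simp add: \<psi>'_def)
  qed
qed

lemma set_integral_absorb:
  fixes F X E :: "'e::euclidean_space \<Rightarrow> real"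
  assumes F: "set_integrable lebesgue Z F" and X: "set_integrable lebesgue Z X"
    and E: "integrable lebesgue E" "\<And>z. 0 \<le> E z"
    and FX: "(LINT z:Z|lebesgue. F z) \<le> (LINT z:Z|lebesgue. X z)"
    and le: "AE z in lebesgue. z \<in> Z \<longrightarrow> X z \<le> 1/2 * F z + E z"
  shows "(LINT z:Z|lebesgue. F z) \<le> 2 * (\<integral>z. E z \<partial>lebesgue)"
proof -
  have "(LINT z:Z|lebesgue. X z) \<le> (\<integral>z. 1/2 * (indicator Z z *\<^sub>R F z) + E z \<partial>lebesgue)"
    unfolding set_lebesgue_integral_def
  proof (rule integral_mono_AE)
    show "AE z in lebesgue. indicator Z z *\<^sub>R X z \<le> 1/2 * (indicator Z z *\<^sub>R F z) + E z"
      using le by eventually_elim (use E in \<open>auto simp: indicator_def\<close>)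
  qed (use F X E in \<open>auto simp: set_integrable_def\<close>)
  also have "\<dots> = 1/2 * (LINT z:Z|lebesgue. F z) + (\<integral>z. E z \<partial>lebesgue)"
    using F E(1) unfolding set_integrable_def set_lebesgue_integral_def by simp
  finally show ?thesis using FX by simp
qed


text \<open>
  The threshold for the small ball around the pole: it is \<open>\<epsilon> / M\<close> up to a constant, so that
  \<open>C * \<epsilon> powr (- q - 1) * M powr (q - 1)\<close> times its power \<open>q - 1\<close> has the order \<open>\<epsilon> powr - 2\<close> of the
  Laplacian.
\<close>

lemma near_threshold:
  fixes \<epsilon> M K C q v :: real
  assumes "0 < \<epsilon>" "0 < M" "0 < K" "0 < C" "1 < q"
    and v: "C * (2 * \<epsilon>) powr (- q - 1) * M powr (q - 1) \<le> v"
  shows "4 * (K / \<epsilon>\<^sup>2) \<le> v * ((4 * K * 2 powr (q + 1) / C) powr (1 / (q - 1)) * \<epsilon> / M) powr (q - 1)"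
proof -
  define h where "h = 4 * K * 2 powr (q + 1) / C"
  have h: "0 < h" using assms by (simp add: h_def)
  have "(h powr (1 / (q - 1)) * \<epsilon> / M) powr (q - 1) = h * \<epsilon> powr (q - 1) / M powr (q - 1)"
    using assms h by (simp add: powr_mult powr_divide powr_powr)
  then have "C * (2 * \<epsilon>) powr (- q - 1) * M powr (q - 1) * (h powr (1 / (q - 1)) * \<epsilon> / M) powr (q - 1)
      = C * h * (2 powr (- q - 1) * (\<epsilon> powr (- q - 1) * \<epsilon> powr (q - 1)))"
    using assms by (simp add: powr_mult)
  also have "\<epsilon> powr (- q - 1) * \<epsilon> powr (q - 1) = inverse (\<epsilon>\<^sup>2)"
    using assms by (simp add: powr_minus powr_numeral flip: powr_add)
  also have "C * h * (2 powr (- q - 1) * inverse (\<epsilon>\<^sup>2)) = 4 * K * (2 powr (q + 1) * 2 powr (- q - 1)) * inverse (\<epsilon>\<^sup>2)"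
    using assms by (simp add: h_def)
  also have "\<dots> = 4 * (K / \<epsilon>\<^sup>2)" by (simp add: divide_inverse flip: powr_add)
  finally show ?thesis
    using mult_right_mono[OF v, of "(h powr (1 / (q - 1)) * \<epsilon> / M) powr (q - 1)"] by (simp add: h_def)
qed

text \<open>
  The threshold for the decay of the time cutoff, with \<open>\<theta> = 1 - t / T\<close>. It blows up as \<open>\<theta>\<close> tends to
  0, and \<open>s\<close> is chosen so large that the factor \<open>\<theta> ^ (s - 1)\<close> compensates for this.
\<close>

lemma far_threshold:
  fixes T V0 q \<theta> :: real and s :: nat
  assumes "0 < T" "0 < V0" "1 < q" "0 < \<theta>" "\<theta> \<le> 1" "1 \<le> s" and s: "1 / (q - 1) \<le> real s - 1"
  defines "m \<equiv> (4 * real s / (V0 * T * \<theta>)) powr (1 / (q - 1))"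
  shows "V0 * m powr (q - 1) = 4 * (real s / (T * \<theta>))"
    and "m * (real s / T * \<theta> ^ (s - 1)) \<le> (4 * real s / V0) powr (1 / (q - 1)) * real s * T powr (- 1 - 1 / (q - 1))"
proof -
  define r where "r = 1 / (q - 1)"
  show "V0 * m powr (q - 1) = 4 * (real s / (T * \<theta>))"
    using assms by (simp add: m_def powr_powr)
  have "m = (4 * real s / V0) powr r * T powr (- r) * \<theta> powr (- r)"
    using assms(1-6) unfolding m_def r_def[symmetric] by (simp add: powr_divide powr_mult powr_minus_divide)
  moreover have "\<theta> ^ (s - 1) = \<theta> powr (real s - 1)"
    using assms(4,6) by (simp add: powr_realpow[symmetric] of_nat_diff)
  moreover have "1 / T = T powr (- 1)" using assms by (simp add: powr_minus divide_inverse)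
  ultimately have "m * (real s / T * \<theta> ^ (s - 1))
      = (4 * real s / V0) powr r * real s * (T powr (- 1) * T powr (- r)) * (\<theta> powr (real s - 1) * \<theta> powr (- r))"
    by (simp add: divide_inverse mult_ac)
  also have "\<dots> = (4 * real s / V0) powr r * real s * T powr (- 1 - r) * \<theta> powr (real s - 1 - r)"
  proof -
    have "T powr (- 1) * T powr (- r) = T powr (- 1 - r)" by (metis powr_add add_uminus_conv_diff)
    moreover have "\<theta> powr (real s - 1) * \<theta> powr (- r) = \<theta> powr (real s - 1 - r)"
      by (metis powr_add add_uminus_conv_diff)
    ultimately show ?thesis by (simp only: mult.assoc)
  qed
  also have "\<dots> \<le> (4 * real s / V0) powr r * real s * T powr (- 1 - r) * 1"
    using assms(4,5) s by (intro mult_left_mono powr_le1) (auto simp: r_def)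
  finally show "m * (real s / T * \<theta> ^ (s - 1)) \<le> (4 * real s / V0) powr (1 / (q - 1)) * real s * T powr (- 1 - 1 / (q - 1))"
    by (simp add: r_def)
qed

section \<open>Vanishing of the solution\<close>

lemma ball_infdist_frontier_subset:
  fixes \<Omega> :: "'a::euclidean_space set"
  assumes "c \<in> \<Omega>" shows "ball c (infdist c (frontier \<Omega>)) \<subseteq> \<Omega>"
proof (rule ccontr)
  assume n: "\<not> ?thesis"
  then obtain x where "dist c x < infdist c (frontier \<Omega>)" by (metis mem_ball subsetI)
  then have "0 < infdist c (frontier \<Omega>)" by (meson le_less_trans zero_le_dist)
  then have "ball c (infdist c (frontier \<Omega>)) \<inter> \<Omega> \<noteq> {}" using assms by force
  then have "ball c (infdist c (frontier \<Omega>)) \<inter> frontier \<Omega> \<noteq> {}"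
    using n by (intro connected_Int_frontier[OF connected_ball]) auto
  then obtain w where "w \<in> frontier \<Omega>" "dist c w < infdist c (frontier \<Omega>)" by auto
  then show False using infdist_le[of w "frontier \<Omega>" c] by simp
qed

lemma frontier_distance:
  fixes \<Omega> :: "'a::euclidean_space set"
  assumes "open \<Omega>" "bounded \<Omega>" "x \<in> \<Omega>"
  obtains p where "p \<in> frontier \<Omega>" "dist p x = infdist x (frontier \<Omega>)"
    "0 < infdist x (frontier \<Omega>)" "infdist x (frontier \<Omega>) \<le> diameter \<Omega>"
proof -
  have "\<Omega> \<noteq> UNIV" using assms(2) not_bounded_UNIV by auto
  then have ne: "frontier \<Omega> \<noteq> {}" using assms(3) by (auto simp: frontier_eq_empty)
  obtain p where p: "p \<in> frontier \<Omega>" "infdist x (frontier \<Omega>) = dist x p"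
    using infdist_attains_inf[OF frontier_closed ne] by metis
  have "p \<notin> \<Omega>" using p(1) assms(1) by (simp add: frontier_def interior_open)
  then have "0 < dist x p" using assms(3) by auto
  moreover have "p \<in> closure \<Omega>" "x \<in> closure \<Omega>" using p(1) assms(3) closure_subset by (auto simp: frontier_def)
  then have "dist x p \<le> diameter (closure \<Omega>)" using assms(2) by (intro diameter_bounded_bound) auto
  then have "dist x p \<le> diameter \<Omega>" using assms(2) by (simp add: diameter_closure)
  ultimately show ?thesis using p by (intro that[of p]) (auto simp: dist_commute)
qed

text \<open>
  The length \<open>T\<close> of the time interval and the lower bound \<open>M\<close> for \<open>f\<close> are independent of each other:
  given \<open>M\<close>, the scale \<open>\<epsilon>\<close> is chosen so small that \<open>f\<close> is at least \<open>M\<close> up to \<open>2 * \<epsilon>\<close>, and the constants do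
  not depend on \<open>\<epsilon>\<close>. On the small ball, \<open>d x < 2 * \<epsilon>\<close> because \<open>p\<close> is a boundary point.
\<close>

lemma weak_solution_energy_bound:
  fixes \<Omega> :: "'a::euclidean_space set" and q C a b :: real and V u :: "'a \<times> real \<Rightarrow> real" and f :: "real \<Rightarrow> real"
  defines "d \<equiv> \<lambda>x. infdist x (frontier \<Omega>)"
  assumes dim: "3 \<le> DIM('a)" and \<Omega>: "open \<Omega>" "bounded \<Omega>" and q: "1 < q"
    and V: "L1_loc (\<Omega> \<times> {0..}) V"
    and f: "\<forall>s\<in>{0<..diameter \<Omega>}. 1 \<le> f s" "filterlim f at_top (at_right 0)"
    and C: "0 < C"
    and VC: "AE z in lebesgue. z \<in> \<Omega> \<times> {0..} \<longrightarrow>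
           V z \<ge> C * d (fst z) powr (- q - 1) * f (d (fst z)) powr (q - 1)"
    and sol: "weak_solution \<Omega> V q u0 u"
    and c: "c \<in> \<Omega>" and a: "0 < a"
  obtains \<kappa> L where "0 < \<kappa>" "\<And>T M. 0 < T \<Longrightarrow> 2 * b \<le> T \<Longrightarrow> 0 < M \<Longrightarrow>
      \<kappa> * (LINT z:cball c (d c / 3) \<times> {2 * a..b}|lebesgue. V z * \<bar>u z\<bar> powr q)
        \<le> L * (T / M + T powr (- 1 / (q - 1)))"
proof -
  define R where "R = d c"
  define Z where "Z = \<Omega> \<times> {0::real<..}"
  define r where "r = 1 / (q - 1)"
  obtain p where p: "p \<in> frontier \<Omega>" "dist p c = R" and R: "0 < R" "R \<le> diameter \<Omega>"
    using frontier_distance[OF \<Omega> c] unfolding R_def d_def by metis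
  have BR: "ball c R \<subseteq> \<Omega>" unfolding R_def d_def by (rule ball_infdist_frontier_subset[OF c])
  obtain K \<epsilon>0 where K: "0 < K" "0 < \<epsilon>0" and
    test: "\<And>\<epsilon>. 0 < \<epsilon> \<Longrightarrow> \<epsilon> < \<epsilon>0 \<Longrightarrow> \<exists>\<phi> G H S y. C2_derivs \<phi> G H \<and>
      compact S \<and> S \<subseteq> ball c R \<and> (\<forall>x. x \<notin> S \<longrightarrow> \<phi> x = 0) \<and> (\<forall>x. 0 \<le> \<phi> x) \<and>
      (\<forall>x\<in>ball c (R/2). 1 \<le> \<phi> x) \<and> ball y (\<epsilon>/4) \<subseteq> ball p (2 * \<epsilon>) \<inter> ball c R \<and>
      (\<forall>x. - laplacian H x \<le> K / \<epsilon>\<^sup>2 * \<phi> x * indicator (ball y (\<epsilon>/4)) x) \<and>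
      (\<forall>x\<in>ball y (\<epsilon>/4). \<phi> x * \<epsilon> ^ (DIM('a) - 1) \<le> K) \<and>
      (\<integral>x. \<phi> x \<partial>lborel) \<le> K"
    using interior_ball_test_function[OF dim R(1) p(2)] by blast
  obtain s :: nat where s: "2 \<le> s" "r \<le> real s - 1"
  proof -
    obtain n :: nat where "r + 1 \<le> real n" using real_arch_simple by blast
    then show thesis by (intro that[of "max 2 n"]) auto
  qed
  define V0 where "V0 = C * diameter \<Omega> powr (- q - 1)"
  have V0: "0 < V0" using C R by (simp add: V0_def)
  define hh where "hh = (4 * K * 2 powr (q + 1) / C) powr r"
  define c2 where "c2 = (4 * real s / V0) powr r * real s"
  define L where "L = 2 * max (hh * K\<^sup>2 * unit_ball_vol (real DIM('a))) (c2 * K)"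
  define \<kappa> :: real where "\<kappa> = (1/2) ^ Suc s"
  have c2: "0 \<le> c2" by (simp add: c2_def)
  have hh: "0 < hh" using K C by (simp add: hh_def)
  have dpos: "0 < d x" "d x \<le> diameter \<Omega>" if "x \<in> \<Omega>" for x
    using frontier_distance[OF \<Omega> that] unfolding d_def by metis+
  have VV0: "AE z in lebesgue. z \<in> \<Omega> \<times> {0..} \<longrightarrow> V0 \<le> V z"
    using VC
  proof eventually_elim
    case (elim z)
    show ?case
    proof
      assume z: "z \<in> \<Omega> \<times> {0..}"
      define D where "D = d (fst z)"
      have D: "0 < D" "D \<le> diameter \<Omega>" using dpos z by (auto simp: D_def)
      then have "1 powr (q - 1) \<le> f D powr (q - 1)" using f(1) q by (intro powr_mono2) auto
      moreover have "diameter \<Omega> powr (- q - 1) \<le> D powr (- q - 1)" using D q by (intro powr_mono2') auto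
      ultimately have "V0 * 1 \<le> C * D powr (- q - 1) * f D powr (q - 1)"
        unfolding V0_def using C by (intro mult_mono) auto
      then show "V0 \<le> V z" using elim z by (simp add: D_def)
    qed
  qed
  have unn: "AE z in lebesgue. z \<in> Z \<longrightarrow> 0 \<le> u z" using sol by (simp add: weak_solution_def Z_def)
  show thesis
  proof (rule that[of \<kappa> L])
    show "0 < \<kappa>" by (simp add: \<kappa>_def)
    fix T M :: real assume T: "0 < T" "2 * b \<le> T" and M: "0 < M"
    obtain \<delta> where \<delta>: "0 < \<delta>" "\<And>s. 0 < s \<Longrightarrow> s < \<delta> \<Longrightarrow> M \<le> f s"
      using f(2) unfolding filterlim_at_top eventually_at_right_field by metis
    obtain \<epsilon> where \<epsilon>: "0 < \<epsilon>" "\<epsilon> < \<epsilon>0" "2 * \<epsilon> < \<delta>"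
    proof
      show "0 < min \<epsilon>0 (\<delta> / 2) / 2" "min \<epsilon>0 (\<delta> / 2) / 2 < \<epsilon>0" "2 * (min \<epsilon>0 (\<delta> / 2) / 2) < \<delta>"
        using K \<delta> by auto
    qed
    obtain \<phi> G H S y where \<phi>: "C2_derivs \<phi> G H" "compact S" and SR: "S \<subseteq> ball c R"
      and \<phi>0: "\<And>x. x \<notin> S \<Longrightarrow> \<phi> x = 0" and \<phi>_nonneg: "\<And>x. 0 \<le> \<phi> x"
      and \<phi>1: "\<And>x. x \<in> ball c (R/2) \<Longrightarrow> 1 \<le> \<phi> x"
      and y: "ball y (\<epsilon>/4) \<subseteq> ball p (2 * \<epsilon>) \<inter> ball c R"
      and laplacian: "\<And>x. - laplacian H x \<le> K / \<epsilon>\<^sup>2 * \<phi> x * indicator (ball y (\<epsilon>/4)) x"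
      and \<phi>K: "\<And>x. x \<in> ball y (\<epsilon>/4) \<Longrightarrow> \<phi> x * \<epsilon> ^ (DIM('a) - 1) \<le> K"
      and int\<phi>: "(\<integral>x. \<phi> x \<partial>lborel) \<le> K"
      using test[OF \<epsilon>(1,2)] by blast
    have S\<Omega>: "S \<subseteq> \<Omega>" using SR BR by blast
    obtain \<psi> \<psi>' where \<psi>: "\<And>t. (\<psi> has_real_derivative \<psi>' t) (at t)" "continuous_on UNIV \<psi>'"
      "\<And>t. t \<notin> {a<..<T} \<Longrightarrow> \<psi> t = 0" "\<And>t. 0 \<le> \<psi> t" "\<And>t. \<psi> t \<le> 1"
      and \<psi>\<kappa>: "\<And>t. 2 * a \<le> t \<Longrightarrow> 2 * t \<le> T \<Longrightarrow> \<kappa> \<le> \<psi> t"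
      and \<psi>\<omega>: "\<And>t. t < T \<Longrightarrow> \<exists>\<omega>. 0 \<le> \<omega> \<and> \<omega> \<le> 1 \<and> \<psi> t = \<omega> * (1 - t / T) ^ s \<and>
        (t \<le> 0 \<longrightarrow> \<omega> = 0) \<and> - \<psi>' t \<le> real s / T * (1 - t / T) ^ (s - 1) * \<omega>"
      and \<psi>'0: "\<And>t. T \<le> t \<Longrightarrow> \<psi>' t = 0"
      using time_cutoff[OF a T(1) s(1)] unfolding \<kappa>_def by metis
    have \<psi>0: "\<psi> t = 0" if "t \<notin> {a..T}" for t using that by (intro \<psi>(3)) auto
    note weak = weak_solution_product_test[OF sol \<Omega>(1) V \<phi> S\<Omega> \<phi>0 \<phi>_nonneg \<psi>(1,2) a \<psi>0 \<psi>(4), folded Z_def]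
    define F where "F = (\<lambda>z. V z * u z powr q * (\<phi> (fst z) * \<psi> (snd z)))"
    define X where "X = (\<lambda>z. u z * (- laplacian H (fst z) * \<psi> (snd z) - \<phi> (fst z) * \<psi>' (snd z)))"
    define c1 where "c1 = hh * K\<^sup>2 / (M * \<epsilon> ^ DIM('a))"
    define c3 where "c3 = c2 * T powr (- 1 - r)"
    have c1: "0 \<le> c1" using hh M \<epsilon> by (simp add: c1_def)
    have c3: "0 \<le> c3" using c2 by (simp add: c3_def)
    define e where "e = (\<lambda>x. c1 * indicator (ball y (\<epsilon>/4)) x + c3 * \<phi> x)"
    define E where "E = (\<lambda>z::'a \<times> real. e (fst z) * indicator {0..T} (snd z))"
    have e0: "0 \<le> e x" for x using c1 c3 \<phi>_nonneg by (simp add: e_def)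
    have pointwise: "AE z in lebesgue. z \<in> Z \<longrightarrow> X z \<le> 1/2 * F z + E z"
      using VC VV0 unn
    proof eventually_elim
      case (elim z)
      show ?case
      proof
        assume z: "z \<in> Z"
        obtain x t where xt: "z = (x, t)" "x \<in> \<Omega>" "0 < t" using z by (auto simp: Z_def)
        have u: "0 \<le> u z" and v: "V0 \<le> V z" "C * d x powr (- q - 1) * f (d x) powr (q - 1) \<le> V z"
          using elim z xt by (auto simp: Z_def)
        have F0: "0 \<le> F z" using v V0 \<phi>_nonneg \<psi>(4) by (simp add: F_def)
        show "X z \<le> 1/2 * F z + E z"
        proof (cases "t < T")
          case False
          then have "\<psi>' t = 0" "\<psi> t = 0" using \<psi>'0 \<psi>(3)[of t] by auto
          then show ?thesis using F0 e0 xt by (simp add: X_def E_def)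
        next
          case True
          define \<theta> where "\<theta> = 1 - t / T"
          have \<theta>: "0 < \<theta>" "\<theta> \<le> 1" using True xt T by (auto simp: \<theta>_def)
          obtain \<omega> where \<omega>: "0 \<le> \<omega>" "\<omega> \<le> 1" "\<psi> t = \<omega> * \<theta> ^ s" "- \<psi>' t \<le> real s / T * \<theta> ^ (s - 1) * \<omega>"
            using \<psi>\<omega>[OF True] unfolding \<theta>_def by blast
          \<comment> \<open>\<open>A1\<close> and \<open>A2\<close> bound the contributions of the Laplacian and of the time derivative.\<close>
          define A1 where "A1 = K / \<epsilon>\<^sup>2 * \<phi> x * indicator (ball y (\<epsilon>/4)) x * \<psi> t"
          define A2 where "A2 = real s / T * \<theta> ^ (s - 1) * (\<phi> x * \<omega>)"
          define m1 where "m1 = hh * \<epsilon> / M"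
          define m2 where "m2 = (4 * real s / (V0 * T * \<theta>)) powr r"
          have "X z = u z * (- laplacian H x * \<psi> t + \<phi> x * - \<psi>' t)" by (simp add: X_def xt)
          also have "\<dots> \<le> u z * (A1 + A2)"
          proof (intro mult_left_mono add_mono u)
            show "- laplacian H x * \<psi> t \<le> A1" unfolding A1_def using laplacian \<psi>(4) by (intro mult_right_mono)
            show "\<phi> x * - \<psi>' t \<le> A2"
              using mult_left_mono[OF \<omega>(4) \<phi>_nonneg[of x]] by (simp add: A2_def mult_ac)
          qed
          also have "\<dots> = u z * A1 + u z * A2" by (simp add: algebra_simps)
          also have "\<dots> \<le> (1/4 * F z + c1 * indicator (ball y (\<epsilon>/4)) x) + (1/4 * F z + c3 * \<phi> x)"
          proof (rule add_mono)
            show "u z * A1 \<le> 1/4 * F z + c1 * indicator (ball y (\<epsilon>/4)) x"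
            proof (cases "x \<in> ball y (\<epsilon>/4)")
              case False
              then show ?thesis using F0 by (simp add: A1_def)
            next
              case x: True
              have A1: "A1 = K / \<epsilon>\<^sup>2 * (\<phi> x * \<psi> t)" using x by (simp add: A1_def)
              have "x \<in> ball p (2 * \<epsilon>)" using y x by blast
              then have D: "0 < d x" "d x < 2 * \<epsilon>"
                using dpos(1)[OF xt(2)] infdist_le[OF p(1), of x] by (auto simp: d_def dist_commute)
              have fM: "M powr (q - 1) \<le> f (d x) powr (q - 1)"
                using \<delta>(2)[OF D(1)] D \<epsilon> M q by (intro powr_mono2) auto
              have dm: "(2 * \<epsilon>) powr (- q - 1) \<le> d x powr (- q - 1)" using D q by (intro powr_mono2') auto
              have "C * (2 * \<epsilon>) powr (- q - 1) * M powr (q - 1) \<le> C * d x powr (- q - 1) * f (d x) powr (q - 1)"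
                using fM dm C by (intro mult_mono mult_left_mono mult_nonneg_nonneg) auto
              from near_threshold[OF \<epsilon>(1) M K(1) C q order_trans[OF this v(2)]] have "4 * (K / \<epsilon>\<^sup>2) \<le> V z * m1 powr (q - 1)"
                unfolding m1_def hh_def r_def .
              then have "u z * A1 \<le> 1/4 * (V z * u z powr q * (\<phi> x * \<psi> t)) + m1 * A1"
                using u v V0 hh \<epsilon> M K \<phi>_nonneg \<psi>(4) q unfolding A1
                by (intro absorb_power[where \<Lambda> = "K / \<epsilon>\<^sup>2"]) (auto simp: m1_def)
              also have "m1 * A1 \<le> c1"
              proof -
                have "\<epsilon> ^ DIM('a) = \<epsilon> * \<epsilon> ^ (DIM('a) - 1)" using dim by (simp flip: power_Suc)
                moreover have "\<phi> x \<le> K / \<epsilon> ^ (DIM('a) - 1)" using \<phi>K[OF x] \<epsilon> by (simp add: field_simps)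
                then have "\<phi> x * \<psi> t \<le> K / \<epsilon> ^ (DIM('a) - 1) * 1"
                  using \<phi>_nonneg[of x] \<psi>(4,5) K \<epsilon> by (intro mult_mono) auto
                then have "m1 * A1 \<le> m1 * (K / \<epsilon>\<^sup>2 * (K / \<epsilon> ^ (DIM('a) - 1)))"
                  unfolding A1 using hh \<epsilon> M K by (intro mult_left_mono) (auto simp: m1_def)
                ultimately show ?thesis
                  using \<epsilon> M by (simp add: m1_def c1_def power2_eq_square)
              qed
              finally show ?thesis using x by (simp add: F_def xt)
            qed
            show "u z * A2 \<le> 1/4 * F z + c3 * \<phi> x"
            proof -
              have s1: "1 \<le> s" using s by simp
              note far = far_threshold[OF T(1) V0 q \<theta> s1 s(2)[unfolded r_def], folded r_def, folded m2_def]
              have "4 * (real s / (T * \<theta>)) \<le> V z * m2 powr (q - 1)"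
                unfolding far(1)[symmetric] using v by (intro mult_right_mono) auto
              moreover have "A2 = real s / (T * \<theta>) * (\<phi> x * \<psi> t)"
              proof -
                have "\<theta> ^ s = \<theta> * \<theta> ^ (s - 1)" using s1 by (simp flip: power_Suc)
                then show ?thesis using \<theta> by (simp add: A2_def \<omega>(3))
              qed
              moreover have "0 \<le> A2" using \<theta> \<omega> T \<phi>_nonneg[of x] by (simp add: A2_def)
              ultimately have "u z * A2 \<le> 1/4 * (V z * u z powr q * (\<phi> x * \<psi> t)) + m2 * A2"
                using u v V0 \<phi>_nonneg[of x] \<psi>(4)[of t] q
                by (intro absorb_power[where \<Lambda> = "real s / (T * \<theta>)"]) (auto simp: m2_def)
              moreover have "m2 * A2 \<le> c3 * \<phi> x"
              proof -
                have "m2 * A2 = m2 * (real s / T * \<theta> ^ (s - 1)) * (\<phi> x * \<omega>)" by (simp add: A2_def)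
                also have "\<dots> \<le> c3 * (\<phi> x * 1)"
                  using far(2) \<phi>_nonneg[of x] \<omega> c3 by (intro mult_mono) (auto simp: c3_def c2_def r_def)
                finally show ?thesis by simp
              qed
              ultimately show ?thesis by (simp add: F_def xt)
            qed
          qed
          finally show ?thesis using True xt by (simp add: E_def e_def)
        qed
      qed
    qed
    have i\<phi>: "integrable lborel \<phi>"
      by (rule integrable_compact_support[OF C2_derivsD(4)[OF \<phi>(1)] \<phi>(2) \<phi>0])
    have ib: "integrable lborel (\<lambda>x::'a. c1 * indicator (ball y (\<epsilon>/4)) x)"
      using emeasure_lborel_ball_finite[of y "\<epsilon>/4"] by (intro integrable_mult_right integrable_real_indicator) auto
    have ie: "integrable lborel e" unfolding e_def using i\<phi> ib by simp
    have it: "integrable lborel (indicator {0..T} :: real \<Rightarrow> real)"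
      using T by (intro integrable_real_indicator) auto
    have IE: "integrable lborel E" and intE: "(\<integral>z. E z \<partial>lborel) = (\<integral>x. e x \<partial>lborel) * T"
      using integral_lborel_product[OF ie e0 it] T unfolding E_def by simp_all
    have Em: "E \<in> borel_measurable lborel" using IE by (rule borel_measurable_integrable)
    have "(LINT z:Z|lebesgue. F z) \<le> 2 * (\<integral>z. E z \<partial>lebesgue)"
    proof (rule set_integral_absorb[OF _ _ _ _ _ pointwise])
      show "integrable lebesgue E" using IE Em by (simp add: integrable_completion)
      show "0 \<le> E z" for z using e0 by (simp add: E_def)
    qed (use weak in \<open>simp_all add: F_def X_def\<close>)
    also have "(\<integral>z. E z \<partial>lebesgue) = (\<integral>x. e x \<partial>lborel) * T"
      using Em intE by (simp add: integral_completion)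
    also have "(\<integral>x. e x \<partial>lborel) = c1 * (unit_ball_vol (real DIM('a)) * (\<epsilon>/4) ^ DIM('a)) + c3 * (\<integral>x. \<phi> x \<partial>lborel)"
      unfolding e_def using i\<phi> ib \<epsilon> by (simp add: content_ball)
    also have "2 * ((c1 * (unit_ball_vol (real DIM('a)) * (\<epsilon>/4) ^ DIM('a)) + c3 * (\<integral>x. \<phi> x \<partial>lborel)) * T)
        \<le> L * (T / M + T powr (- 1 / (q - 1)))"
    proof -
      have "c1 * (unit_ball_vol (real DIM('a)) * (\<epsilon>/4) ^ DIM('a)) * T
          = hh * K\<^sup>2 * unit_ball_vol (real DIM('a)) * (T / M) / 4 ^ DIM('a)"
        using \<epsilon> M by (simp add: c1_def power_divide)
      also have "\<dots> \<le> hh * K\<^sup>2 * unit_ball_vol (real DIM('a)) * (T / M)"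
        using hh T M divide_left_mono[of 1 "4 ^ DIM('a)" "hh * K\<^sup>2 * unit_ball_vol (real DIM('a)) * (T / M)"]
        by simp
      also have "\<dots> \<le> L / 2 * (T / M)" using T M by (intro mult_right_mono) (auto simp: L_def)
      finally have 1: "c1 * (unit_ball_vol (real DIM('a)) * (\<epsilon>/4) ^ DIM('a)) * T \<le> L / 2 * (T / M)" .
      have "T powr (- 1 - r) * T = T powr (- 1 / (q - 1))"
        using T powr_mult_base[of T "- 1 - r"] by (simp add: r_def mult.commute)
      then have "c3 * (\<integral>x. \<phi> x \<partial>lborel) * T = c2 * (\<integral>x. \<phi> x \<partial>lborel) * T powr (- 1 / (q - 1))"
        by (simp add: c3_def mult_ac)
      also have "\<dots> \<le> c2 * K * T powr (- 1 / (q - 1))"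
        using int\<phi> c2 by (intro mult_right_mono mult_left_mono) auto
      also have "\<dots> \<le> L / 2 * T powr (- 1 / (q - 1))" by (intro mult_right_mono) (auto simp: L_def)
      finally show ?thesis using 1 by (simp add: algebra_simps)
    qed
    finally have FL: "(LINT z:Z|lebesgue. F z) \<le> L * (T / M + T powr (- 1 / (q - 1)))" .
    \<comment> \<open>Compact, so that the powers of \<open>u\<close> are integrable, and within the region where \<open>\<phi> \<ge> 1\<close>.\<close>
    define P where "P = cball c (R / 3) \<times> {2 * a..b}"
    have PZ: "P \<subseteq> Z" using BR R a by (force simp: P_def Z_def)
    have "set_integrable lebesgue P (\<lambda>z. V z * norm (u z) powr q)"
    proof -
      have "compact P" "P \<subseteq> \<Omega> \<times> {0..}" using PZ by (auto simp: P_def Z_def compact_Times)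
      then show ?thesis using sol unfolding weak_solution_def Lp_loc_def by blast
    qed
    then have iP: "integrable lebesgue (\<lambda>z. \<kappa> * (indicator P z *\<^sub>R (V z * \<bar>u z\<bar> powr q)))"
      by (simp add: set_integrable_def)
    have "\<kappa> * (LINT z:P|lebesgue. V z * \<bar>u z\<bar> powr q) = (\<integral>z. \<kappa> * (indicator P z *\<^sub>R (V z * \<bar>u z\<bar> powr q)) \<partial>lebesgue)"
      unfolding set_lebesgue_integral_def by simp
    also have "\<dots> \<le> (LINT z:Z|lebesgue. F z)"
      unfolding set_lebesgue_integral_def
    proof (rule integral_mono_AE[OF iP])
      show "integrable lebesgue (\<lambda>z. indicator Z z *\<^sub>R F z)" using weak(1) by (simp add: set_integrable_def F_def)
      show "AE z in lebesgue. \<kappa> * (indicator P z *\<^sub>R (V z * \<bar>u z\<bar> powr q)) \<le> indicator Z z *\<^sub>R F z"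
        using VV0 unn
      proof eventually_elim
        case (elim z)
        show ?case
        proof (cases "z \<in> Z")
          case False
          then have "z \<notin> P" using PZ by blast
          then show ?thesis using False by simp
        next
          case z: True
          have v: "0 \<le> V z * u z powr q" and u: "0 \<le> u z" using elim z V0 by (auto simp: Z_def)
          show ?thesis
          proof (cases "z \<in> P")
            case False
            then show ?thesis using z v \<phi>_nonneg \<psi>(4) by (simp add: F_def)
          next
            case True
            then have "1 \<le> \<phi> (fst z)" "\<kappa> \<le> \<psi> (snd z)"
              using R T by (auto simp: P_def intro!: \<phi>1 \<psi>\<kappa>)
            then have "1 * \<kappa> \<le> \<phi> (fst z) * \<psi> (snd z)" by (intro mult_mono) (auto simp: \<kappa>_def)
            from mult_left_mono[OF this v] show ?thesis using True z u by (simp add: F_def mult_ac)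
          qed
        qed
      qed
    qed
    finally show "\<kappa> * (LINT z:cball c (d c / 3) \<times> {2 * a..b}|lebesgue. V z * \<bar>u z\<bar> powr q)
        \<le> L * (T / M + T powr (- 1 / (q - 1)))"
      using FL by (simp add: P_def R_def)
  qed
qed

text \<open>
  With \<open>M = T\<^sup>2\<close> the bound is a multiple of \<open>1 / T + T powr (- 1 / (q - 1))\<close>, which tends to 0 as
  \<open>T\<close> tends to infinity.
\<close>

lemma weak_solution_vanishes_locally:
  fixes \<Omega> :: "'a::euclidean_space set" and q C a b :: real and V u :: "'a \<times> real \<Rightarrow> real" and f :: "real \<Rightarrow> real"
  defines "d \<equiv> \<lambda>x. infdist x (frontier \<Omega>)"
  assumes dim: "3 \<le> DIM('a)" and \<Omega>: "open \<Omega>" "bounded \<Omega>" and q: "1 < q"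
    and V: "L1_loc (\<Omega> \<times> {0..}) V"
    and f: "\<forall>s\<in>{0<..diameter \<Omega>}. 1 \<le> f s" "filterlim f at_top (at_right 0)"
    and C: "0 < C"
    and VC: "AE z in lebesgue. z \<in> \<Omega> \<times> {0..} \<longrightarrow>
           V z \<ge> C * d (fst z) powr (- q - 1) * f (d (fst z)) powr (q - 1)"
    and sol: "weak_solution \<Omega> V q u0 u"
    and c: "c \<in> \<Omega>" and a: "0 < a"
  shows "AE z in lebesgue. z \<in> cball c (d c / 3) \<times> {2 * a..b} \<longrightarrow> u z = 0"
proof -
  define P where "P = cball c (d c / 3) \<times> {2 * a..b}"
  have dpos: "0 < d x" "d x \<le> diameter \<Omega>" if "x \<in> \<Omega>" for x
    using frontier_distance[OF \<Omega> that] unfolding d_def by metis+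
  have P: "P \<subseteq> \<Omega> \<times> {0<..}" "P \<subseteq> \<Omega> \<times> {0..}" "compact P"
  proof -
    have "cball c (d c / 3) \<subseteq> ball c (d c)" using dpos(1)[OF c] by auto
    then have "cball c (d c / 3) \<subseteq> \<Omega>" using ball_infdist_frontier_subset[OF c] unfolding d_def by blast
    then show "P \<subseteq> \<Omega> \<times> {0<..}" "P \<subseteq> \<Omega> \<times> {0..}" using a by (auto simp: P_def)
    show "compact P" by (simp add: P_def compact_Times)
  qed
  define J where "J = (LINT z:P|lebesgue. V z * \<bar>u z\<bar> powr q)"
  obtain \<kappa> L where \<kappa>: "0 < \<kappa>" and bound: "\<And>T M. 0 < T \<Longrightarrow> 2 * b \<le> T \<Longrightarrow> 0 < M \<Longrightarrow>
      \<kappa> * J \<le> L * (T / M + T powr (- 1 / (q - 1)))"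
  proof (rule weak_solution_energy_bound[OF dim \<Omega> q V f C VC[unfolded d_def] sol c a, of b])
    fix \<kappa> L :: real
    assume "0 < \<kappa>" and "\<And>T M. 0 < T \<Longrightarrow> 2 * b \<le> T \<Longrightarrow> 0 < M \<Longrightarrow>
      \<kappa> * (LINT z:cball c (infdist c (frontier \<Omega>) / 3) \<times> {2 * a..b}|lebesgue. V z * \<bar>u z\<bar> powr q)
        \<le> L * (T / M + T powr (- 1 / (q - 1)))"
    then show thesis by (rule that[unfolded J_def P_def d_def])
  qed
  have J: "J \<le> 0"
  proof -
    have "((\<lambda>T. L * (inverse T + T powr (- 1 / (q - 1)))) \<longlongrightarrow> L * (0 + 0)) at_top"
      using q by (intro tendsto_intros tendsto_inverse_0_at_top filterlim_ident tendsto_neg_powr) auto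
    moreover have "\<forall>\<^sub>F T in at_top. \<kappa> * J \<le> L * (inverse T + T powr (- 1 / (q - 1)))"
      using eventually_ge_at_top[of "max 1 (2 * b)"]
    proof eventually_elim
      case (elim T)
      then have "\<kappa> * J \<le> L * (T / T\<^sup>2 + T powr (- 1 / (q - 1)))" by (intro bound) auto
      also have "T / T\<^sup>2 = inverse T" using elim by (simp add: power2_eq_square field_simps)
      finally show ?case .
    qed
    ultimately have "\<kappa> * J \<le> L * (0 + 0)" by (rule tendsto_lowerbound) simp
    with \<kappa> show ?thesis by (simp add: mult_le_0_iff)
  qed
  have "set_integrable lebesgue P (\<lambda>z. V z * norm (u z) powr q)"
    using sol P unfolding weak_solution_def Lp_loc_def by blast
  then have int: "integrable lebesgue (\<lambda>z. indicator P z *\<^sub>R (V z * \<bar>u z\<bar> powr q))"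
    by (simp add: set_integrable_def)
  have Vpos: "AE z in lebesgue. z \<in> P \<longrightarrow> 0 < V z"
    using VC
  proof eventually_elim
    case (elim z)
    show ?case
    proof
      assume z: "z \<in> P"
      then have D: "0 < d (fst z)" "d (fst z) \<le> diameter \<Omega>" using dpos P(1) by auto
      then have "1 \<le> f (d (fst z))" using f(1) by auto
      then have "0 < C * d (fst z) powr (- q - 1) * f (d (fst z)) powr (q - 1)" using C D by simp
      then show "0 < V z" using elim z P(2) by force
    qed
  qed
  then have nn: "AE z in lebesgue. 0 \<le> indicator P z *\<^sub>R (V z * \<bar>u z\<bar> powr q)"
    by eventually_elim (auto simp: indicator_def)
  have "0 \<le> J" unfolding J_def set_lebesgue_integral_def by (rule integral_nonneg_AE[OF nn])
  with J have "(\<integral>z. indicator P z *\<^sub>R (V z * \<bar>u z\<bar> powr q) \<partial>lebesgue) = 0"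
    by (simp add: J_def set_lebesgue_integral_def)
  then have "AE z in lebesgue. indicator P z *\<^sub>R (V z * \<bar>u z\<bar> powr q) = 0"
    using integral_nonneg_eq_0_iff_AE[OF int nn] by blast
  then have "AE z in lebesgue. z \<in> P \<longrightarrow> u z = 0"
    using Vpos by eventually_elim auto
  then show ?thesis by (simp only: P_def)
qed

lemma AE_lebesgue_locally:
  fixes Z :: "'e::euclidean_space set"
  assumes "\<And>z. z \<in> Z \<Longrightarrow> \<exists>U. open U \<and> z \<in> U \<and> (AE w in lebesgue. w \<in> U \<inter> Z \<longrightarrow> Q w)"
  shows "AE w in lebesgue. w \<in> Z \<longrightarrow> Q w"
proof -
  define B where "B = {w \<in> Z. \<not> Q w}"
  have "negligible B"
    unfolding locally_negligible_alt[of B]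
  proof
    fix z assume z: "z \<in> B"
    then obtain U where U: "open U" "z \<in> U" "AE w in lebesgue. w \<in> U \<inter> Z \<longrightarrow> Q w"
      using assms by (auto simp: B_def)
    have "{w. \<not> (w \<in> U \<inter> Z \<longrightarrow> Q w)} = B \<inter> U" by (auto simp: B_def)
    then have "negligible (B \<inter> U)"
      using U(3) unfolding eventually_ae_filter_negligible by (auto intro: negligible_subset)
    then show "\<exists>U. openin (top_of_set B) U \<and> z \<in> U \<and> negligible U"
      using z U by (intro exI[of _ "B \<inter> U"]) (auto simp: openin_open)
  qed
  then show ?thesis unfolding eventually_ae_filter_negligible B_def by blast
qed

theorem corollary2p7:
  fixes \<Omega> :: "(real ^ 'n) set"
    and q C :: real
    and u0 :: "real ^ 'n \<Rightarrow> real"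
    and V u :: "(real ^ 'n) \<times> real \<Rightarrow> real"
    and f :: "real \<Rightarrow> real"
  defines "d \<equiv> \<lambda>x. infdist x (frontier \<Omega>)"
  assumes "CARD('n) \<ge> 3"
    and "open \<Omega>" and "bounded \<Omega>" and "connected \<Omega>"
    and "q > 1"
    and "L1_loc \<Omega> u0" and "AE x in lebesgue. x \<in> \<Omega> \<longrightarrow> 0 \<le> u0 x"
    and "L1_loc (\<Omega> \<times> {0..}) V"
    and "\<forall>s\<in>{0<..diameter \<Omega>}. 1 \<le> f s"
    and "\<exists>\<delta>>0. antimono_on {0<..<\<delta>} f"
    and "filterlim f at_top (at_right 0)"
    and "C > 0"
    and "AE z in lebesgue. z \<in> \<Omega> \<times> {0..} \<longrightarrow>
           V z \<ge> C * d (fst z) powr (- q - 1) * f (d (fst z)) powr (q - 1)"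
    and "weak_solution \<Omega> V q u0 u"
  shows "AE z in lebesgue. z \<in> \<Omega> \<times> {0<..} \<longrightarrow> u z = 0"
proof (rule AE_lebesgue_locally)
  fix z :: "(real ^ 'n) \<times> real" assume "z \<in> \<Omega> \<times> {0<..}"
  then obtain c t where z: "z = (c, t)" "c \<in> \<Omega>" "0 < t" by auto
  have dim: "3 \<le> DIM(real ^ 'n)" using assms(2) by simp
  have dc: "0 < d c" using frontier_distance[OF assms(3,4) z(2)] unfolding d_def by metis
  have "AE w in lebesgue. w \<in> cball c (d c / 3) \<times> {2 * (t / 4)..2 * t} \<longrightarrow> u w = 0"
    unfolding d_def
    by (rule weak_solution_vanishes_locally[OF dim assms(3,4,6,9,10,12,13) assms(14)[unfolded d_def] assms(15) z(2)])
      (use z in simp)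
  then have "AE w in lebesgue. w \<in> (ball c (d c / 3) \<times> {t / 2<..<2 * t}) \<inter> \<Omega> \<times> {0<..} \<longrightarrow> u w = 0"
    by eventually_elim auto
  moreover have "open (ball c (d c / 3) \<times> {t / 2<..<2 * t})" by (intro open_Times) auto
  ultimately show "\<exists>U. open U \<and> z \<in> U \<and> (AE w in lebesgue. w \<in> U \<inter> \<Omega> \<times> {0<..} \<longrightarrow> u w = 0)"
    using z dc by (intro exI[of _ "ball c (d c / 3) \<times> {t / 2<..<2 * t}"]) auto
qed

end
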